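(* Let $P$ be a unital subsemigroup of a discrete group $G$ and let $X$ be a product system over $P$. Let $t$ be an equivariant representation of $X$, let $\dot t$ be the equivariant Fock-covariant representation of $X$ associated with $t$, given by $\dot t(\xi_p)=q_t(t(\xi_p))$ where $q_t\colon \mathrm{C}^*(t)\to \mathrm{C}^*(t)/t_*(\ker q_{\mathrm{c}}^{\mathrm{F}})=\mathrm{C}^*(\dot t)$ is the quotient map, so that $q_t\, t_*=\dot t_*\, q_{\mathrm{c}}^{\mathrm{F}}$ on $\mathcal{T}(X)$. Then $t$ is injective and covariant if and only if $\dot t$ is injective.
   Context: **Product systems.** $P$ is a unital discrete left-cancellative semigroup with unit $e$. A product system $X$ over $P$ is a family $\{X_p\}_{p\in P}$ of closed subspaces of some $\mathcal{B}(H)$ such that $A := X_e$ is a C*-algebra, $X_p\cdot X_q\subseteq X_{pq}$ and $X_p^*\cdot X_{pq}\subseteq X_q$ for all $p,q\in P$. Each $X_p$ is a C*-correspondence over $A$ with operations from $\mathcal{B}(H)$ and $\langle \xi,\eta\rangle=\xi^*\eta$. **Representations.** A (Toeplitz) representation $t=\{t_p\}_{p\in P}$ of $X$ is a family of linear maps $t_p$ of $X_p$ into a common C*-algebra such that $t_e$ is a $*$-representation of $A$, $t_p(\xi_p)t_q(\xi_q)=t_{pq}(\xi_p\xi_q)$ and $t_p(\xi_p)^*t_{pq}(\xi_{pq})=t_q(\xi_p^*\xi_{pq})$. One writes $t$ for any $t_p$; $t$ is injective if it is injective on $A$. $\mathcal{T}(X)$ is the universal C*-algebra generated by $X$ with respect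 to representations of $X$; $t_*\colon\mathcal{T}(X)\to \mathrm{C}^*(t)$ is the induced $*$-homomorphism, with $\mathrm{C}^*(t)=\mathrm{C}^*(t(\xi_p)\mid \xi_p\in X_p,\ p\in P)$. **Coactions.** $u_g$ are the generators of $\mathrm{C}^*_{\max}(G)$, $\otimes$ is the spatial tensor product. A coaction of $G$ on a C*-algebra $\mathcal{C}$ is a faithful $*$-homomorphism $\delta\colon\mathcal{C}\to\mathcal{C}\otimes \mathrm{C}^*_{\max}(G)$ such that the spaces $[\mathcal{C}]_g=\{c\mid\delta(c)=c\otimes u_g\}$ densely span $\mathcal{C}$. A representation $t$ of $X$ is equivariant if $\mathrm{C}^*(t)$ admits a coaction of $G$ with $t(\xi_p)\mapsto t(\xi_p)\otimes u_p$. $\mathcal{T}(X)$ carries such a coaction. **Fock covariance.** $\mathcal{F}X=\bigoplus_{r\in P}X_r$ (right Hilbert $A$-module), and $\lambda(\xi_p)\eta_r=\xi_p\eta_r$ defines an injective representation $\lambda$ of $X$ by adjointable operators. $\mathcal{T}_{\mathrm{c}}^{\mathrm{F}}(X)$ is the quotient of $\mathcal{T}(X)$ by the ideal generated by $\ker\lambda_*\cap[\mathcal{T}(X)]_e$, with quotient map $q_{\mathrm{c}}^{\mathrm{F}}\colon\mathcal{T}(X)\to\mathcal{T}_{\mathrm{c}}^{\mathrm{F}}(X)$. A representation of $X$ is Fock-covariant if its induced $*$-homomorphism factors through $\mathcal{T}_{\mathrm{c}}^{\mathrm{F}}(X)$; for $\dot t$ Fock-covariant, $\dot t_*$ denotes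 the induced map on $\mathcal{T}_{\mathrm{c}}^{\mathrm{F}}(X)$. An equivariant representation $t$ of $X$ is covariant if $$t(A)\cap [t_*(\ker q_{\mathrm{c}}^{\mathrm{F}})]_e=(0),\qquad [t_*(\ker q_{\mathrm{c}}^{\mathrm{F}})]_e=t_*(\ker q_{\mathrm{c}}^{\mathrm{F}})\cap[\mathrm{C}^*(t)]_e.$$ *)

theory Defs
  imports Complex_Main "HOL-Algebra.Group"
begin

text \<open>
  Complex vector spaces, Hilbert spaces and (not necessarily unital) C*-algebras are records with
  an explicit carrier, so that subalgebras, quotients and completions are again of the same kind.
  Inner products are linear in the second variable.
\<close>

section \<open>Vector spaces, star-algebras and C*-algebras\<close>

record 'a cvs = "'a partial_object" +
  vadd :: "'a \<Rightarrow> 'a \<Rightarrow> 'a"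
  vzero :: 'a
  vscale :: "complex \<Rightarrow> 'a \<Rightarrow> 'a"

record 'a staralg = "'a cvs" +
  amult :: "'a \<Rightarrow> 'a \<Rightarrow> 'a"
  astar :: "'a \<Rightarrow> 'a"

record 'a cstar = "'a staralg" +
  anorm :: "'a \<Rightarrow> real"

record ('e, 'b) ipspace = "'e cvs" +
  ip :: "'e \<Rightarrow> 'e \<Rightarrow> 'b"

definition vsub :: "('a, 'm) cvs_scheme \<Rightarrow> 'a \<Rightarrow> 'a \<Rightarrow> 'a" where
  "vsub V x y = vadd V x (vscale V (-1) y)"

definition vsum :: "('a, 'm) cvs_scheme \<Rightarrow> ('i \<Rightarrow> 'a) \<Rightarrow> 'i set \<Rightarrow> 'a" where
  "vsum V f F = Finite_Set.fold (\<lambda>i. vadd V (f i)) (vzero V) F"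

definition seq_converges ::
  "('a, 'm) cvs_scheme \<Rightarrow> ('a \<Rightarrow> real) \<Rightarrow> (nat \<Rightarrow> 'a) \<Rightarrow> 'a \<Rightarrow> bool" where
  "seq_converges V N s x \<longleftrightarrow> (\<lambda>n. N (vsub V (s n) x)) \<longlonglongrightarrow> 0"

definition seq_cauchy :: "('a, 'm) cvs_scheme \<Rightarrow> ('a \<Rightarrow> real) \<Rightarrow> (nat \<Rightarrow> 'a) \<Rightarrow> bool" where
  "seq_cauchy V N s \<longleftrightarrow> (\<forall>\<epsilon>>0. \<exists>M. \<forall>m\<ge>M. \<forall>n\<ge>M. N (vsub V (s m) (s n)) < \<epsilon>)"

definition norm_complete :: "('a, 'm) cvs_scheme \<Rightarrow> ('a \<Rightarrow> real) \<Rightarrow> bool" where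
  "norm_complete V N \<longleftrightarrow>
     (\<forall>s. range s \<subseteq> carrier V \<and> seq_cauchy V N s \<longrightarrow> (\<exists>x\<in>carrier V. seq_converges V N s x))"

text \<open>Unconditional convergence of a sum, i.e. convergence of the net of finite partial sums.\<close>

definition has_vsum ::
  "('a, 'm) cvs_scheme \<Rightarrow> ('a \<Rightarrow> real) \<Rightarrow> ('i \<Rightarrow> 'a) \<Rightarrow> 'i set \<Rightarrow> 'a \<Rightarrow> bool" where
  "has_vsum V N f I s \<longleftrightarrow>
     (\<forall>\<epsilon>>0. \<exists>F0. finite F0 \<and> F0 \<subseteq> I \<and>
        (\<forall>F. finite F \<and> F0 \<subseteq> F \<and> F \<subseteq> I \<longrightarrow> N (vsub V (vsum V f F) s) < \<epsilon>))"

locale complex_vs =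
  fixes V :: "('a, 'm) cvs_scheme"
  assumes zero_closed: "vzero V \<in> carrier V"
    and add_closed: "\<lbrakk>x \<in> carrier V; y \<in> carrier V\<rbrakk> \<Longrightarrow> vadd V x y \<in> carrier V"
    and scale_closed: "x \<in> carrier V \<Longrightarrow> vscale V c x \<in> carrier V"
    and add_assoc: "\<lbrakk>x \<in> carrier V; y \<in> carrier V; z \<in> carrier V\<rbrakk>
      \<Longrightarrow> vadd V (vadd V x y) z = vadd V x (vadd V y z)"
    and add_commute: "\<lbrakk>x \<in> carrier V; y \<in> carrier V\<rbrakk> \<Longrightarrow> vadd V x y = vadd V y x"
    and add_zero: "x \<in> carrier V \<Longrightarrow> vadd V x (vzero V) = x"
    and add_neg: "x \<in> carrier V \<Longrightarrow> vadd V x (vscale V (-1) x) = vzero V"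
    and scale_one: "x \<in> carrier V \<Longrightarrow> vscale V 1 x = x"
    and scale_scale: "x \<in> carrier V \<Longrightarrow> vscale V c (vscale V d x) = vscale V (c * d) x"
    and scale_add_right: "\<lbrakk>x \<in> carrier V; y \<in> carrier V\<rbrakk>
      \<Longrightarrow> vscale V c (vadd V x y) = vadd V (vscale V c x) (vscale V c y)"
    and scale_add_left: "x \<in> carrier V
      \<Longrightarrow> vscale V (c + d) x = vadd V (vscale V c x) (vscale V d x)"

locale star_algebra = complex_vs A for A :: "('a, 'm) staralg_scheme" +
  assumes mult_closed: "\<lbrakk>x \<in> carrier A; y \<in> carrier A\<rbrakk> \<Longrightarrow> amult A x y \<in> carrier A"
    and star_closed: "x \<in> carrier A \<Longrightarrow> astar A x \<in> carrier A"
    and mult_assoc: "\<lbrakk>x \<in> carrier A; y \<in> carrier A; z \<in> carrier A\<rbrakk>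
      \<Longrightarrow> amult A (amult A x y) z = amult A x (amult A y z)"
    and mult_add_left: "\<lbrakk>x \<in> carrier A; y \<in> carrier A; z \<in> carrier A\<rbrakk>
      \<Longrightarrow> amult A (vadd A x y) z = vadd A (amult A x z) (amult A y z)"
    and mult_add_right: "\<lbrakk>x \<in> carrier A; y \<in> carrier A; z \<in> carrier A\<rbrakk>
      \<Longrightarrow> amult A x (vadd A y z) = vadd A (amult A x y) (amult A x z)"
    and mult_scale_left: "\<lbrakk>x \<in> carrier A; y \<in> carrier A\<rbrakk>
      \<Longrightarrow> amult A (vscale A c x) y = vscale A c (amult A x y)"
    and mult_scale_right: "\<lbrakk>x \<in> carrier A; y \<in> carrier A\<rbrakk>
      \<Longrightarrow> amult A x (vscale A c y) = vscale A c (amult A x y)"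
    and star_star: "x \<in> carrier A \<Longrightarrow> astar A (astar A x) = x"
    and star_add: "\<lbrakk>x \<in> carrier A; y \<in> carrier A\<rbrakk>
      \<Longrightarrow> astar A (vadd A x y) = vadd A (astar A x) (astar A y)"
    and star_scale: "x \<in> carrier A \<Longrightarrow> astar A (vscale A c x) = vscale A (cnj c) (astar A x)"
    and star_mult: "\<lbrakk>x \<in> carrier A; y \<in> carrier A\<rbrakk>
      \<Longrightarrow> astar A (amult A x y) = amult A (astar A y) (astar A x)"

definition cstar_seminorm :: "('a, 'm) staralg_scheme \<Rightarrow> ('a \<Rightarrow> real) \<Rightarrow> bool" where
  "cstar_seminorm A N \<longleftrightarrow>
     (\<forall>x\<in>carrier A. 0 \<le> N x) \<and>
     (\<forall>x\<in>carrier A. \<forall>y\<in>carrier A. N (vadd A x y) \<le> N x + N y) \<and>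
     (\<forall>c. \<forall>x\<in>carrier A. N (vscale A c x) = cmod c * N x) \<and>
     (\<forall>x\<in>carrier A. \<forall>y\<in>carrier A. N (amult A x y) \<le> N x * N y) \<and>
     (\<forall>x\<in>carrier A. N (amult A (astar A x) x) = (N x)\<^sup>2)"

locale cstar_algebra = star_algebra A for A :: "('a, 'm) cstar_scheme" +
  assumes seminorm: "cstar_seminorm A (anorm A)"
    and norm_definite: "\<lbrakk>x \<in> carrier A; anorm A x = 0\<rbrakk> \<Longrightarrow> x = vzero A"
    and complete: "norm_complete A (anorm A)"

definition star_hom ::
  "('a, 'm) staralg_scheme \<Rightarrow> ('b, 'n) staralg_scheme \<Rightarrow> ('a \<Rightarrow> 'b) \<Rightarrow> bool" where
  "star_hom A B \<phi> \<longleftrightarrow>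
     (\<forall>x\<in>carrier A. \<phi> x \<in> carrier B) \<and>
     (\<forall>x\<in>carrier A. \<forall>y\<in>carrier A. \<phi> (vadd A x y) = vadd B (\<phi> x) (\<phi> y)) \<and>
     (\<forall>c. \<forall>x\<in>carrier A. \<phi> (vscale A c x) = vscale B c (\<phi> x)) \<and>
     (\<forall>x\<in>carrier A. \<forall>y\<in>carrier A. \<phi> (amult A x y) = amult B (\<phi> x) (\<phi> y)) \<and>
     (\<forall>x\<in>carrier A. \<phi> (astar A x) = astar B (\<phi> x))"

definition alg_ker :: "('a, 'm) staralg_scheme \<Rightarrow> ('b, 'n) staralg_scheme \<Rightarrow> ('a \<Rightarrow> 'b) \<Rightarrow> 'a set" where
  "alg_ker A B \<phi> = {x \<in> carrier A. \<phi> x = vzero B}"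

definition closed_subspace :: "('a, 'm) cvs_scheme \<Rightarrow> ('a \<Rightarrow> real) \<Rightarrow> 'a set \<Rightarrow> bool" where
  "closed_subspace V N S \<longleftrightarrow>
     S \<subseteq> carrier V \<and> vzero V \<in> S \<and>
     (\<forall>x\<in>S. \<forall>y\<in>S. vadd V x y \<in> S) \<and>
     (\<forall>c. \<forall>x\<in>S. vscale V c x \<in> S) \<and>
     (\<forall>s x. range s \<subseteq> S \<and> x \<in> carrier V \<and> seq_converges V N s x \<longrightarrow> x \<in> S)"

definition closed_span :: "('a, 'm) cstar_scheme \<Rightarrow> 'a set \<Rightarrow> 'a set" where
  "closed_span A S = \<Inter>{L. closed_subspace A (anorm A) L \<and> S \<subseteq> L}"

definition cstar_generated :: "('a, 'm) cstar_scheme \<Rightarrow> 'a set \<Rightarrow> 'a set" where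
  "cstar_generated A S = \<Inter>{L. closed_subspace A (anorm A) L \<and>
     (\<forall>x\<in>L. \<forall>y\<in>L. amult A x y \<in> L) \<and> (\<forall>x\<in>L. astar A x \<in> L) \<and> S \<subseteq> L}"

definition closed_ideal :: "('a, 'm) cstar_scheme \<Rightarrow> 'a set \<Rightarrow> bool" where
  "closed_ideal A J \<longleftrightarrow> closed_subspace A (anorm A) J \<and>
     (\<forall>x\<in>carrier A. \<forall>y\<in>J. amult A x y \<in> J \<and> amult A y x \<in> J)"

definition ideal_generated :: "('a, 'm) cstar_scheme \<Rightarrow> 'a set \<Rightarrow> 'a set" where
  "ideal_generated A S = \<Inter>{J. closed_ideal A J \<and> S \<subseteq> J}"

section \<open>Quotients and completions\<close>

definition coset :: "('a, 'm) cvs_scheme \<Rightarrow> 'a set \<Rightarrow> 'a \<Rightarrow> 'a set" where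
  "coset A J x = (\<lambda>y. vadd A x y) ` J"

definition quotient_alg :: "('a, 'm) cstar_scheme \<Rightarrow> 'a set \<Rightarrow> 'a set cstar" where
  "quotient_alg A J =
     \<lparr>carrier = coset A J ` carrier A,
      vadd = (\<lambda>S T. \<Union>x\<in>S. \<Union>y\<in>T. coset A J (vadd A x y)),
      vzero = coset A J (vzero A),
      vscale = (\<lambda>c S. \<Union>x\<in>S. coset A J (vscale A c x)),
      amult = (\<lambda>S T. \<Union>x\<in>S. \<Union>y\<in>T. coset A J (amult A x y)),
      astar = (\<lambda>S. \<Union>x\<in>S. coset A J (astar A x)),
      anorm = (\<lambda>S. Inf (anorm A ` S))\<rparr>"

text \<open>
  The Hausdorff completion of a star-algebra with respect to a C*-seminorm \<open>N\<close>: Cauchy sequences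
  modulo null sequences.
\<close>

definition cauchy_alg :: "('a, 'm) staralg_scheme \<Rightarrow> ('a \<Rightarrow> real) \<Rightarrow> (nat \<Rightarrow> 'a) cstar" where
  "cauchy_alg A N =
     \<lparr>carrier = {s. range s \<subseteq> carrier A \<and> seq_cauchy A N s},
      vadd = (\<lambda>s t n. vadd A (s n) (t n)),
      vzero = (\<lambda>n. vzero A),
      vscale = (\<lambda>c s n. vscale A c (s n)),
      amult = (\<lambda>s t n. amult A (s n) (t n)),
      astar = (\<lambda>s n. astar A (s n)),
      anorm = (\<lambda>s. lim (\<lambda>n. N (s n)))\<rparr>"

definition null_seqs :: "('a, 'm) staralg_scheme \<Rightarrow> ('a \<Rightarrow> real) \<Rightarrow> (nat \<Rightarrow> 'a) set" where
  "null_seqs A N = {s. range s \<subseteq> carrier A \<and> (\<lambda>n. N (s n)) \<longlonglongrightarrow> 0}"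

definition completion :: "('a, 'm) staralg_scheme \<Rightarrow> ('a \<Rightarrow> real) \<Rightarrow> (nat \<Rightarrow> 'a) set cstar" where
  "completion A N = quotient_alg (cauchy_alg A N) (null_seqs A N)"

definition to_completion ::
  "('a, 'm) staralg_scheme \<Rightarrow> ('a \<Rightarrow> real) \<Rightarrow> 'a \<Rightarrow> (nat \<Rightarrow> 'a) set" where
  "to_completion A N a = coset (cauchy_alg A N) (null_seqs A N) (\<lambda>n. a)"

section \<open>Universal C*-algebras and the full group C*-algebra\<close>

text \<open>
  The complex star-algebra with linear basis a semigroup \<open>S\<close> with involution \<open>st\<close>
  (finitely supported functions with convolution).
\<close>

definition semigroup_alg ::
  "'s set \<Rightarrow> ('s \<Rightarrow> 's \<Rightarrow> 's) \<Rightarrow> ('s \<Rightarrow> 's) \<Rightarrow> ('s \<Rightarrow> complex) staralg" where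
  "semigroup_alg S m st =
     \<lparr>carrier = {f. finite {s. f s \<noteq> 0} \<and> {s. f s \<noteq> 0} \<subseteq> S},
      vadd = (\<lambda>f g s. f s + g s),
      vzero = (\<lambda>s. 0),
      vscale = (\<lambda>c f s. c * f s),
      amult = (\<lambda>f g s. \<Sum>(u, v)\<in>{(u, v). f u \<noteq> 0 \<and> g v \<noteq> 0 \<and> m u v = s}. f u * g v),
      astar = (\<lambda>f s. if s \<in> S then cnj (f (st s)) else 0)\<rparr>"

definition basis_elt :: "'s \<Rightarrow> 's \<Rightarrow> complex" where
  "basis_elt s = (\<lambda>s'. if s' = s then 1 else 0)"

text \<open>
  The universal C*-algebra of a star-algebra \<open>A\<close> subject to relations \<open>x = y\<close> for \<open>(x, y) \<in> R\<close>:
  completion in the supremum of all C*-seminorms compatible with \<open>R\<close>. As the C*-seminorms on \<open>A\<close>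
  are exactly the functions \<open>x \<mapsto> \<parallel>\<pi>(x)\<parallel>\<close> for star-homomorphisms \<open>\<pi>\<close> into C*-algebras, this is the
  usual construction, without a quantification over the type of the target.
\<close>

definition max_seminorm :: "('a, 'm) staralg_scheme \<Rightarrow> ('a \<times> 'a) set \<Rightarrow> 'a \<Rightarrow> real" where
  "max_seminorm A R x =
     Sup {N x |N. cstar_seminorm A N \<and> (\<forall>(y, z)\<in>R. N (vsub A y z) = 0)}"

definition universal_cstar ::
  "('a, 'm) staralg_scheme \<Rightarrow> ('a \<times> 'a) set \<Rightarrow> (nat \<Rightarrow> 'a) set cstar" where
  "universal_cstar A R = completion A (max_seminorm A R)"

definition to_universal ::
  "('a, 'm) staralg_scheme \<Rightarrow> ('a \<times> 'a) set \<Rightarrow> 'a \<Rightarrow> (nat \<Rightarrow> 'a) set" where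
  "to_universal A R = to_completion A (max_seminorm A R)"

definition group_alg :: "('g, 'k) monoid_scheme \<Rightarrow> ('g \<Rightarrow> complex) staralg" where
  "group_alg G = semigroup_alg (carrier G) (mult G) (m_inv G)"

type_synonym 'g group_cstar_elt = "(nat \<Rightarrow> 'g \<Rightarrow> complex) set"

definition max_group_cstar :: "('g, 'k) monoid_scheme \<Rightarrow> 'g group_cstar_elt cstar" where
  "max_group_cstar G = universal_cstar (group_alg G) {}"

definition group_unitary :: "('g, 'k) monoid_scheme \<Rightarrow> 'g \<Rightarrow> 'g group_cstar_elt" where
  "group_unitary G g = to_universal (group_alg G) {} (basis_elt g)"

section \<open>Operators\<close>

text \<open>
  Bounded linear operators with an adjoint, on a space with a (possibly algebra-valued) inner
  product; \<open>N\<close> is the norm on the values of the inner product, so that \<open>\<parallel>x\<parallel> = N(\<langle>x,x\<rangle>)\<^sup>1\<^sup>/\<^sup>2\<close>. For a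
  Hilbert space this is the algebra of all bounded operators, and for a Hilbert module the algebra
  of adjointable operators. Operators are \<open>undefined\<close> outside the carrier.
\<close>

definition ip_norm :: "('e, 'b, 'm) ipspace_scheme \<Rightarrow> ('b \<Rightarrow> real) \<Rightarrow> 'e \<Rightarrow> real" where
  "ip_norm E N x = sqrt (N (ip E x x))"

definition is_adjoint :: "('e, 'b, 'm) ipspace_scheme \<Rightarrow> ('e \<Rightarrow> 'e) \<Rightarrow> ('e \<Rightarrow> 'e) \<Rightarrow> bool" where
  "is_adjoint E T S \<longleftrightarrow> S \<in> carrier E \<rightarrow>\<^sub>E carrier E \<and>
     (\<forall>x\<in>carrier E. \<forall>y\<in>carrier E. ip E (S x) y = ip E x (T y))"

definition operator_alg ::
  "('e, 'b, 'm) ipspace_scheme \<Rightarrow> ('b \<Rightarrow> real) \<Rightarrow> ('e \<Rightarrow> 'e) cstar" where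
  "operator_alg E N =
     \<lparr>carrier = {T \<in> carrier E \<rightarrow>\<^sub>E carrier E.
        (\<forall>x\<in>carrier E. \<forall>y\<in>carrier E. T (vadd E x y) = vadd E (T x) (T y)) \<and>
        (\<forall>c. \<forall>x\<in>carrier E. T (vscale E c x) = vscale E c (T x)) \<and>
        (\<exists>K. \<forall>x\<in>carrier E. ip_norm E N (T x) \<le> K * ip_norm E N x) \<and>
        (\<exists>S. is_adjoint E T S)},
      vadd = (\<lambda>S T. \<lambda>x\<in>carrier E. vadd E (S x) (T x)),
      vzero = (\<lambda>x\<in>carrier E. vzero E),
      vscale = (\<lambda>c T. \<lambda>x\<in>carrier E. vscale E c (T x)),
      amult = (\<lambda>S T. \<lambda>x\<in>carrier E. S (T x)),
      astar = (\<lambda>T. THE S. is_adjoint E T S),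
      anorm = (\<lambda>T. Sup {ip_norm E N (T x) |x. x \<in> carrier E \<and> ip_norm E N x \<le> 1})\<rparr>"

locale hilbert_space = complex_vs H for H :: "('h, complex) ipspace" +
  assumes ip_add: "\<lbrakk>x \<in> carrier H; y \<in> carrier H; z \<in> carrier H\<rbrakk>
      \<Longrightarrow> ip H x (vadd H y z) = ip H x y + ip H x z"
    and ip_scale: "\<lbrakk>x \<in> carrier H; y \<in> carrier H\<rbrakk> \<Longrightarrow> ip H x (vscale H c y) = c * ip H x y"
    and ip_conj: "\<lbrakk>x \<in> carrier H; y \<in> carrier H\<rbrakk> \<Longrightarrow> ip H y x = cnj (ip H x y)"
    and ip_nonneg: "x \<in> carrier H \<Longrightarrow> 0 \<le> Re (ip H x x)"
    and ip_definite: "\<lbrakk>x \<in> carrier H; ip H x x = 0\<rbrakk> \<Longrightarrow> x = vzero H"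
    and hilbert_complete: "norm_complete H (ip_norm H cmod)"

definition bounded_ops :: "('h, complex) ipspace \<Rightarrow> ('h \<Rightarrow> 'h) cstar" where
  "bounded_ops H = operator_alg H cmod"

section \<open>Spatial tensor products and coactions\<close>

text \<open>
  The norm of \<open>\<Sum>i\<in>F. u i \<otimes> v i\<close> in the Hilbert space tensor product of \<open>H\<close> and \<open>K\<close>, computed from
  \<open>\<langle>u \<otimes> v, u' \<otimes> v'\<rangle> = \<langle>u,u'\<rangle> \<langle>v,v'\<rangle>\<close>.
\<close>

definition tensor_vec_norm ::
  "('h, complex) ipspace \<Rightarrow> ('k, complex) ipspace \<Rightarrow> 'i set \<Rightarrow> ('i \<Rightarrow> 'h) \<Rightarrow> ('i \<Rightarrow> 'k) \<Rightarrow> real" where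
  "tensor_vec_norm H K F u v =
     sqrt (Re (\<Sum>i\<in>F. \<Sum>j\<in>F. ip H (u i) (u j) * ip K (v i) (v j)))"

text \<open>
  Formal linear combinations of elementary tensors \<open>(a, b)\<close>; the bilinearity relations are in the
  kernel of the spatial seminorm below, and hence hold in the completion.
\<close>

definition tensor_pre :: "('a, 'm) staralg_scheme \<Rightarrow> ('b, 'n) staralg_scheme
    \<Rightarrow> ('a \<times> 'b \<Rightarrow> complex) staralg" where
  "tensor_pre A B = semigroup_alg (carrier A \<times> carrier B)
     (\<lambda>(a, b) (a', b'). (amult A a a', amult B b b')) (\<lambda>(a, b). (astar A a, astar B b))"

text \<open>
  The operator norm of \<open>(\<pi> \<otimes> \<sigma>)(x) = \<Sum> x(a,b) \<pi>(a) \<otimes> \<sigma>(b)\<close> on the tensor product of \<open>H\<close> and \<open>K\<close>,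
  as the supremum over the unit ball of the dense subspace of vectors \<open>\<Sum>i<n. h i \<otimes> k i\<close>.
\<close>

definition tensor_rep_norm ::
  "('h, complex) ipspace \<Rightarrow> ('k, complex) ipspace \<Rightarrow> ('a \<Rightarrow> 'h \<Rightarrow> 'h) \<Rightarrow> ('b \<Rightarrow> 'k \<Rightarrow> 'k)
    \<Rightarrow> ('a \<times> 'b \<Rightarrow> complex) \<Rightarrow> real" where
  "tensor_rep_norm H K \<pi> \<sigma> x =
     Sup {tensor_vec_norm H K ({ab. x ab \<noteq> 0} \<times> {..<n})
            (\<lambda>((a, b), i). vscale H (x (a, b)) (\<pi> a (h i))) (\<lambda>((a, b), i). \<sigma> b (k i)) |
          (n :: nat) h k. (\<forall>i<n. h i \<in> carrier H \<and> k i \<in> carrier K) \<and>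
            tensor_vec_norm H K {..<n} h k \<le> 1}"

text \<open>
  The spatial norm is attained on any pair of faithful representations and dominates every
  \<open>\<pi> \<otimes> \<sigma>\<close>. It is enough to consider Hilbert spaces with carrier in the type \<open>(nat \<Rightarrow> 'a) set\<close>:
  the universal representation is a sum of GNS representations, whose spaces are completions of
  quotients of the algebra and so consist of equivalence classes of sequences in the algebra.
\<close>

definition spatial_seminorm ::
  "('a, 'm) staralg_scheme \<Rightarrow> ('b, 'n) staralg_scheme \<Rightarrow> ('a \<times> 'b \<Rightarrow> complex) \<Rightarrow> real" where
  "spatial_seminorm A B x =
     Sup {tensor_rep_norm H K \<pi> \<sigma> x |
          (H :: ((nat \<Rightarrow> 'a) set, complex) ipspace) (K :: ((nat \<Rightarrow> 'b) set, complex) ipspace) \<pi> \<sigma>.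
            hilbert_space H \<and> hilbert_space K \<and>
            star_hom A (bounded_ops H) \<pi> \<and> star_hom B (bounded_ops K) \<sigma>}"

type_synonym ('a, 'b) tensor_elt = "(nat \<Rightarrow> 'a \<times> 'b \<Rightarrow> complex) set"

definition spatial_tensor ::
  "('a, 'm) staralg_scheme \<Rightarrow> ('b, 'n) staralg_scheme \<Rightarrow> ('a, 'b) tensor_elt cstar" where
  "spatial_tensor A B = completion (tensor_pre A B) (spatial_seminorm A B)"

definition elem_tensor ::
  "('a, 'm) staralg_scheme \<Rightarrow> ('b, 'n) staralg_scheme \<Rightarrow> 'a \<Rightarrow> 'b \<Rightarrow> ('a, 'b) tensor_elt" where
  "elem_tensor A B a b =
     to_completion (tensor_pre A B) (spatial_seminorm A B) (basis_elt (a, b))"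

text \<open>
  \<open>spectral G C \<delta> S g\<close> is \<open>[S]\<^sub>g\<close>, for \<open>S\<close> the algebra \<open>C\<close> itself or an ideal of \<open>C\<close> with the
  restricted coaction.
\<close>

definition spectral ::
  "('g, 'k) monoid_scheme \<Rightarrow> 'c cstar \<Rightarrow> ('c \<Rightarrow> ('c, 'g group_cstar_elt) tensor_elt)
    \<Rightarrow> 'c set \<Rightarrow> 'g \<Rightarrow> 'c set" where
  "spectral G C \<delta> S g = {c \<in> S. \<delta> c = elem_tensor C (max_group_cstar G) c (group_unitary G g)}"

definition coaction ::
  "('g, 'k) monoid_scheme \<Rightarrow> 'c cstar \<Rightarrow> ('c \<Rightarrow> ('c, 'g group_cstar_elt) tensor_elt) \<Rightarrow> bool" where
  "coaction G C \<delta> \<longleftrightarrow>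
     star_hom C (spatial_tensor C (max_group_cstar G)) \<delta> \<and> inj_on \<delta> (carrier C) \<and>
     closed_span C (\<Union>g\<in>carrier G. spectral G C \<delta> (carrier C) g) = carrier C"

section \<open>Product systems and their representations\<close>

text \<open>The C*-algebra \<open>A = X\<^sub>e\<close>, with the operations of the bounded operators on \<open>H\<close>.\<close>

definition coeff_alg ::
  "('h, complex) ipspace \<Rightarrow> ('p, 'k) monoid_scheme \<Rightarrow> ('p \<Rightarrow> ('h \<Rightarrow> 'h) set) \<Rightarrow> ('h \<Rightarrow> 'h) cstar" where
  "coeff_alg H P X = (bounded_ops H)\<lparr>carrier := X \<one>\<^bsub>P\<^esub>\<rparr>"

definition product_system ::
  "('h, complex) ipspace \<Rightarrow> ('p, 'k) monoid_scheme \<Rightarrow> ('p \<Rightarrow> ('h \<Rightarrow> 'h) set) \<Rightarrow> bool" where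
  "product_system H P X \<longleftrightarrow>
     hilbert_space H \<and> monoid P \<and>
     (\<forall>p\<in>carrier P. \<forall>q\<in>carrier P. \<forall>r\<in>carrier P. p \<otimes>\<^bsub>P\<^esub> q = p \<otimes>\<^bsub>P\<^esub> r \<longrightarrow> q = r) \<and>
     (\<forall>p\<in>carrier P. closed_subspace (bounded_ops H) (anorm (bounded_ops H)) (X p)) \<and>
     cstar_algebra (coeff_alg H P X) \<and>
     (\<forall>p\<in>carrier P. \<forall>q\<in>carrier P. \<forall>\<xi>\<in>X p. \<forall>\<eta>\<in>X q.
        amult (bounded_ops H) \<xi> \<eta> \<in> X (p \<otimes>\<^bsub>P\<^esub> q)) \<and>
     (\<forall>p\<in>carrier P. \<forall>q\<in>carrier P. \<forall>\<xi>\<in>X p. \<forall>\<zeta>\<in>X (p \<otimes>\<^bsub>P\<^esub> q).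
        amult (bounded_ops H) (astar (bounded_ops H) \<xi>) \<zeta> \<in> X q)"

definition representation ::
  "('h, complex) ipspace \<Rightarrow> ('p, 'k) monoid_scheme \<Rightarrow> ('p \<Rightarrow> ('h \<Rightarrow> 'h) set)
    \<Rightarrow> 'b cstar \<Rightarrow> ('p \<Rightarrow> ('h \<Rightarrow> 'h) \<Rightarrow> 'b) \<Rightarrow> bool" where
  "representation H P X B t \<longleftrightarrow>
     cstar_algebra B \<and>
     (\<forall>p\<in>carrier P. \<forall>\<xi>\<in>X p. t p \<xi> \<in> carrier B) \<and>
     (\<forall>p\<in>carrier P. \<forall>\<xi>\<in>X p. \<forall>\<eta>\<in>X p.
        t p (vadd (bounded_ops H) \<xi> \<eta>) = vadd B (t p \<xi>) (t p \<eta>)) \<and>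
     (\<forall>p\<in>carrier P. \<forall>c. \<forall>\<xi>\<in>X p. t p (vscale (bounded_ops H) c \<xi>) = vscale B c (t p \<xi>)) \<and>
     star_hom (coeff_alg H P X) B (t \<one>\<^bsub>P\<^esub>) \<and>
     (\<forall>p\<in>carrier P. \<forall>q\<in>carrier P. \<forall>\<xi>\<in>X p. \<forall>\<eta>\<in>X q.
        amult B (t p \<xi>) (t q \<eta>) = t (p \<otimes>\<^bsub>P\<^esub> q) (amult (bounded_ops H) \<xi> \<eta>)) \<and>
     (\<forall>p\<in>carrier P. \<forall>q\<in>carrier P. \<forall>\<xi>\<in>X p. \<forall>\<zeta>\<in>X (p \<otimes>\<^bsub>P\<^esub> q).
        amult B (astar B (t p \<xi>)) (t (p \<otimes>\<^bsub>P\<^esub> q) \<zeta>)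
          = t q (amult (bounded_ops H) (astar (bounded_ops H) \<xi>) \<zeta>))"

definition injective_rep ::
  "('p, 'k) monoid_scheme \<Rightarrow> ('p \<Rightarrow> ('h \<Rightarrow> 'h) set) \<Rightarrow> ('p \<Rightarrow> ('h \<Rightarrow> 'h) \<Rightarrow> 'b) \<Rightarrow> bool" where
  "injective_rep P X t \<longleftrightarrow> inj_on (t \<one>\<^bsub>P\<^esub>) (X \<one>\<^bsub>P\<^esub>)"

definition rep_cstar ::
  "('p, 'k) monoid_scheme \<Rightarrow> ('p \<Rightarrow> ('h \<Rightarrow> 'h) set) \<Rightarrow> 'b cstar \<Rightarrow> ('p \<Rightarrow> ('h \<Rightarrow> 'h) \<Rightarrow> 'b)
    \<Rightarrow> 'b cstar" where
  "rep_cstar P X B t = B\<lparr>carrier := cstar_generated B (\<Union>p\<in>carrier P. t p ` X p)\<rparr>"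

text \<open>
  The free star-algebra on symbols \<open>(p, \<xi>)\<close> with \<open>\<xi> \<in> X p\<close>: its basis consists of the nonempty
  words in the letters \<open>(p, \<xi>, False)\<close> and their formal adjoints \<open>(p, \<xi>, True)\<close>.
\<close>

type_synonym ('p, 'x) ps_word = "('p \<times> 'x \<times> bool) list"

definition free_alg ::
  "('p, 'k) monoid_scheme \<Rightarrow> ('p \<Rightarrow> 'x set) \<Rightarrow> (('p, 'x) ps_word \<Rightarrow> complex) staralg" where
  "free_alg P X = semigroup_alg
     {w. w \<noteq> [] \<and> (\<forall>(p, \<xi>, b)\<in>set w. p \<in> carrier P \<and> \<xi> \<in> X p)}
     (@) (\<lambda>w. rev (map (\<lambda>(p, \<xi>, b). (p, \<xi>, \<not> b)) w))"

definition free_gen :: "'p \<Rightarrow> 'x \<Rightarrow> ('p, 'x) ps_word \<Rightarrow> complex" where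
  "free_gen p \<xi> = basis_elt [(p, \<xi>, False)]"

definition toeplitz_relations ::
  "('h, complex) ipspace \<Rightarrow> ('p, 'k) monoid_scheme \<Rightarrow> ('p \<Rightarrow> ('h \<Rightarrow> 'h) set)
    \<Rightarrow> ((('p, 'h \<Rightarrow> 'h) ps_word \<Rightarrow> complex) \<times> (('p, 'h \<Rightarrow> 'h) ps_word \<Rightarrow> complex)) set" where
  "toeplitz_relations H P X =
     (let W = free_alg P X; BH = bounded_ops H in
     {(free_gen p (vadd BH \<xi> \<eta>), vadd W (free_gen p \<xi>) (free_gen p \<eta>)) |p \<xi> \<eta>.
        p \<in> carrier P \<and> \<xi> \<in> X p \<and> \<eta> \<in> X p} \<union>
     {(free_gen p (vscale BH c \<xi>), vscale W c (free_gen p \<xi>)) |p c \<xi>.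
        p \<in> carrier P \<and> \<xi> \<in> X p} \<union>
     {(free_gen \<one>\<^bsub>P\<^esub> (astar BH a), astar W (free_gen \<one>\<^bsub>P\<^esub> a)) |a. a \<in> X \<one>\<^bsub>P\<^esub>} \<union>
     {(amult W (free_gen p \<xi>) (free_gen q \<eta>), free_gen (p \<otimes>\<^bsub>P\<^esub> q) (amult BH \<xi> \<eta>)) |p q \<xi> \<eta>.
        p \<in> carrier P \<and> q \<in> carrier P \<and> \<xi> \<in> X p \<and> \<eta> \<in> X q} \<union>
     {(amult W (astar W (free_gen p \<xi>)) (free_gen (p \<otimes>\<^bsub>P\<^esub> q) \<zeta>),
       free_gen q (amult BH (astar BH \<xi>) \<zeta>)) |p q \<xi> \<zeta>.
        p \<in> carrier P \<and> q \<in> carrier P \<and> \<xi> \<in> X p \<and> \<zeta> \<in> X (p \<otimes>\<^bsub>P\<^esub> q)})"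

type_synonym ('p, 'h) toeplitz_elt = "(nat \<Rightarrow> ('p, 'h \<Rightarrow> 'h) ps_word \<Rightarrow> complex) set"

definition toeplitz_alg ::
  "('h, complex) ipspace \<Rightarrow> ('p, 'k) monoid_scheme \<Rightarrow> ('p \<Rightarrow> ('h \<Rightarrow> 'h) set)
    \<Rightarrow> ('p, 'h) toeplitz_elt cstar" where
  "toeplitz_alg H P X = universal_cstar (free_alg P X) (toeplitz_relations H P X)"

definition toeplitz_gen ::
  "('h, complex) ipspace \<Rightarrow> ('p, 'k) monoid_scheme \<Rightarrow> ('p \<Rightarrow> ('h \<Rightarrow> 'h) set)
    \<Rightarrow> 'p \<Rightarrow> ('h \<Rightarrow> 'h) \<Rightarrow> ('p, 'h) toeplitz_elt" where
  "toeplitz_gen H P X p \<xi> = to_universal (free_alg P X) (toeplitz_relations H P X) (free_gen p \<xi>)"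

text \<open>
  The induced star-homomorphism \<open>t\<^sub>*\<close>. It is unique on the carrier, because star-homomorphisms of
  C*-algebras are contractive and the Toeplitz algebra is generated by the elements \<open>toeplitz_gen\<close>.
\<close>

definition induced_hom ::
  "('h, complex) ipspace \<Rightarrow> ('p, 'k) monoid_scheme \<Rightarrow> ('p \<Rightarrow> ('h \<Rightarrow> 'h) set)
    \<Rightarrow> 'b cstar \<Rightarrow> ('p \<Rightarrow> ('h \<Rightarrow> 'h) \<Rightarrow> 'b) \<Rightarrow> ('p, 'h) toeplitz_elt \<Rightarrow> 'b" where
  "induced_hom H P X B t =
     (SOME \<phi>. star_hom (toeplitz_alg H P X) B \<phi> \<and>
        (\<forall>p\<in>carrier P. \<forall>\<xi>\<in>X p. \<phi> (toeplitz_gen H P X p \<xi>) = t p \<xi>))"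

text \<open>The coaction of \<open>G\<close> on the Toeplitz algebra, induced by \<open>\<xi>\<^sub>p \<mapsto> \<xi>\<^sub>p \<otimes> u\<^sub>p\<close>.\<close>

definition toeplitz_coaction ::
  "('g, 'l) monoid_scheme \<Rightarrow> ('h, complex) ipspace \<Rightarrow> ('g, 'k) monoid_scheme
    \<Rightarrow> ('g \<Rightarrow> ('h \<Rightarrow> 'h) set) \<Rightarrow> ('g, 'h) toeplitz_elt
    \<Rightarrow> (('g, 'h) toeplitz_elt, 'g group_cstar_elt) tensor_elt" where
  "toeplitz_coaction G H P X =
     induced_hom H P X (spatial_tensor (toeplitz_alg H P X) (max_group_cstar G))
       (\<lambda>p \<xi>. elem_tensor (toeplitz_alg H P X) (max_group_cstar G)
          (toeplitz_gen H P X p \<xi>) (group_unitary G p))"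

text \<open>
  \<open>t\<close> is equivariant if there is some \<open>\<delta>\<close> as follows; such a \<open>\<delta>\<close> is unique on the carrier of
  \<open>C*(t)\<close>.
\<close>

definition equivariant_rep ::
  "('g, 'l) monoid_scheme \<Rightarrow> ('h, complex) ipspace \<Rightarrow> ('g, 'k) monoid_scheme
    \<Rightarrow> ('g \<Rightarrow> ('h \<Rightarrow> 'h) set) \<Rightarrow> 'b cstar \<Rightarrow> ('g \<Rightarrow> ('h \<Rightarrow> 'h) \<Rightarrow> 'b)
    \<Rightarrow> ('b \<Rightarrow> ('b, 'g group_cstar_elt) tensor_elt) \<Rightarrow> bool" where
  "equivariant_rep G H P X B t \<delta> \<longleftrightarrow>
     representation H P X B t \<and> coaction G (rep_cstar P X B t) \<delta> \<and>
     (\<forall>p\<in>carrier P. \<forall>\<xi>\<in>X p.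
        \<delta> (t p \<xi>) = elem_tensor (rep_cstar P X B t) (max_group_cstar G) (t p \<xi>) (group_unitary G p))"

section \<open>Fock covariance\<close>

text \<open>
  The direct sum of Hilbert modules: families \<open>\<eta>\<close> with \<open>\<eta> r \<in> X r\<close> for which \<open>\<Sum>r. (\<eta> r)* (\<eta> r)\<close>
  converges in norm. The sums lie in the closed subspace \<open>X\<^sub>e\<close>.
\<close>

definition fock_module ::
  "('h, complex) ipspace \<Rightarrow> ('p, 'k) monoid_scheme \<Rightarrow> ('p \<Rightarrow> ('h \<Rightarrow> 'h) set)
    \<Rightarrow> ('p \<Rightarrow> 'h \<Rightarrow> 'h, 'h \<Rightarrow> 'h) ipspace" where
  "fock_module H P X =
     (let BH = bounded_ops H; A = coeff_alg H P X in
     \<lparr>carrier = {\<eta> \<in> (\<Pi>\<^sub>E r\<in>carrier P. X r).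
        \<exists>s\<in>carrier A. has_vsum A (anorm A) (\<lambda>r. amult BH (astar BH (\<eta> r)) (\<eta> r)) (carrier P) s},
      vadd = (\<lambda>\<eta> \<zeta>. \<lambda>r\<in>carrier P. vadd BH (\<eta> r) (\<zeta> r)),
      vzero = (\<lambda>r\<in>carrier P. vzero BH),
      vscale = (\<lambda>c \<eta>. \<lambda>r\<in>carrier P. vscale BH c (\<eta> r)),
      ip = (\<lambda>\<eta> \<zeta>. THE s. s \<in> carrier A \<and>
        has_vsum A (anorm A) (\<lambda>r. amult BH (astar BH (\<eta> r)) (\<zeta> r)) (carrier P) s)\<rparr>)"

definition fock_ops ::
  "('h, complex) ipspace \<Rightarrow> ('p, 'k) monoid_scheme \<Rightarrow> ('p \<Rightarrow> ('h \<Rightarrow> 'h) set)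
    \<Rightarrow> (('p \<Rightarrow> 'h \<Rightarrow> 'h) \<Rightarrow> ('p \<Rightarrow> 'h \<Rightarrow> 'h)) cstar" where
  "fock_ops H P X = operator_alg (fock_module H P X) (anorm (coeff_alg H P X))"

text \<open>
  \<open>\<lambda>(\<xi>\<^sub>p)\<close> maps \<open>\<eta>\<^sub>r\<close> in the summand \<open>r\<close> to \<open>\<xi>\<^sub>p \<eta>\<^sub>r\<close> in the summand \<open>p r\<close>; the index \<open>r\<close> is
  determined by \<open>p r\<close> by left cancellation.
\<close>

definition fock_rep ::
  "('h, complex) ipspace \<Rightarrow> ('p, 'k) monoid_scheme \<Rightarrow> ('p \<Rightarrow> ('h \<Rightarrow> 'h) set)
    \<Rightarrow> 'p \<Rightarrow> ('h \<Rightarrow> 'h) \<Rightarrow> ('p \<Rightarrow> 'h \<Rightarrow> 'h) \<Rightarrow> ('p \<Rightarrow> 'h \<Rightarrow> 'h)" where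
  "fock_rep H P X p \<xi> =
     (\<lambda>\<eta>\<in>carrier (fock_module H P X). \<lambda>s\<in>carrier P.
        if \<exists>r\<in>carrier P. s = p \<otimes>\<^bsub>P\<^esub> r
        then amult (bounded_ops H) \<xi> (\<eta> (THE r. r \<in> carrier P \<and> s = p \<otimes>\<^bsub>P\<^esub> r))
        else vzero (bounded_ops H))"

definition fock_ideal ::
  "('g, 'l) monoid_scheme \<Rightarrow> ('h, complex) ipspace \<Rightarrow> ('g, 'k) monoid_scheme
    \<Rightarrow> ('g \<Rightarrow> ('h \<Rightarrow> 'h) set) \<Rightarrow> ('g, 'h) toeplitz_elt set" where
  "fock_ideal G H P X =
     (let T = toeplitz_alg H P X in
      ideal_generated T
        (alg_ker T (fock_ops H P X) (induced_hom H P X (fock_ops H P X) (fock_rep H P X)) \<inter>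
         spectral G T (toeplitz_coaction G H P X) (carrier T) \<one>\<^bsub>G\<^esub>))"

definition fock_cov_alg ::
  "('g, 'l) monoid_scheme \<Rightarrow> ('h, complex) ipspace \<Rightarrow> ('g, 'k) monoid_scheme
    \<Rightarrow> ('g \<Rightarrow> ('h \<Rightarrow> 'h) set) \<Rightarrow> ('g, 'h) toeplitz_elt set cstar" where
  "fock_cov_alg G H P X = quotient_alg (toeplitz_alg H P X) (fock_ideal G H P X)"

definition fock_quotient ::
  "('g, 'l) monoid_scheme \<Rightarrow> ('h, complex) ipspace \<Rightarrow> ('g, 'k) monoid_scheme
    \<Rightarrow> ('g \<Rightarrow> ('h \<Rightarrow> 'h) set) \<Rightarrow> ('g, 'h) toeplitz_elt \<Rightarrow> ('g, 'h) toeplitz_elt set" where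
  "fock_quotient G H P X = coset (toeplitz_alg H P X) (fock_ideal G H P X)"

text \<open>The image under \<open>t\<^sub>*\<close> of the kernel of the quotient map \<open>fock_quotient\<close>.\<close>

definition covariance_ideal ::
  "('g, 'l) monoid_scheme \<Rightarrow> ('h, complex) ipspace \<Rightarrow> ('g, 'k) monoid_scheme
    \<Rightarrow> ('g \<Rightarrow> ('h \<Rightarrow> 'h) set) \<Rightarrow> 'b cstar \<Rightarrow> ('g \<Rightarrow> ('h \<Rightarrow> 'h) \<Rightarrow> 'b) \<Rightarrow> 'b set" where
  "covariance_ideal G H P X B t =
     induced_hom H P X (rep_cstar P X B t) t `
       alg_ker (toeplitz_alg H P X) (fock_cov_alg G H P X) (fock_quotient G H P X)"

text \<open>
  In \<open>[t\<^sub>*(ker q)]\<^sub>e\<close> the ideal \<open>t\<^sub>*(ker q)\<close> carries the restriction of the coaction of \<open>C*(t)\<close>.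
\<close>

definition covariant_rep ::
  "('g, 'l) monoid_scheme \<Rightarrow> ('h, complex) ipspace \<Rightarrow> ('g, 'k) monoid_scheme
    \<Rightarrow> ('g \<Rightarrow> ('h \<Rightarrow> 'h) set) \<Rightarrow> 'b cstar \<Rightarrow> ('g \<Rightarrow> ('h \<Rightarrow> 'h) \<Rightarrow> 'b)
    \<Rightarrow> ('b \<Rightarrow> ('b, 'g group_cstar_elt) tensor_elt) \<Rightarrow> bool" where
  "covariant_rep G H P X B t \<delta> \<longleftrightarrow>
     (let C = rep_cstar P X B t; I = covariance_ideal G H P X B t in
      t \<one>\<^bsub>P\<^esub> ` X \<one>\<^bsub>P\<^esub> \<inter> spectral G C \<delta> I \<one>\<^bsub>G\<^esub> = {vzero B} \<and>
      spectral G C \<delta> I \<one>\<^bsub>G\<^esub> = I \<inter> spectral G C \<delta> (carrier C) \<one>\<^bsub>G\<^esub>)"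

text \<open>
  The Fock-covariant representation \<open>\<xi>\<^sub>p \<mapsto> q\<^sub>t(t(\<xi>\<^sub>p))\<close> associated with \<open>t\<close>, where \<open>q\<^sub>t\<close> is the
  quotient map of \<open>C*(t)\<close> by \<open>t\<^sub>*(ker q)\<close>.
\<close>

definition fock_cov_rep ::
  "('g, 'l) monoid_scheme \<Rightarrow> ('h, complex) ipspace \<Rightarrow> ('g, 'k) monoid_scheme
    \<Rightarrow> ('g \<Rightarrow> ('h \<Rightarrow> 'h) set) \<Rightarrow> 'b cstar \<Rightarrow> ('g \<Rightarrow> ('h \<Rightarrow> 'h) \<Rightarrow> 'b)
    \<Rightarrow> 'g \<Rightarrow> ('h \<Rightarrow> 'h) \<Rightarrow> 'b set" where
  "fock_cov_rep G H P X B t p \<xi> =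
     coset (rep_cstar P X B t) (covariance_ideal G H P X B t) (t p \<xi>)"

end

theory Submission
  imports Defs "HOL-Algebra.FiniteProduct"
begin

text \<open>
Let \<open>C = C*(t)\<close> and let \<open>I\<close> be the image under \<open>t\<^sub>*\<close> of the kernel of the quotient map onto the
Fock-covariant algebra. The composition of \<open>t\<close> with the quotient map by \<open>I\<close> is injective on \<open>A\<close> if and
only if \<open>t\<close> is injective on \<open>A\<close> and \<open>t(A) \<inter> I = 0\<close> (\<open>coset_injective_iff\<close>). Equivariance places \<open>t(A)\<close>
in the fixed point algebra of the coaction, so that \<open>t(A) \<inter> I = t(A) \<inter> [I]\<^sub>e\<close>, and \<open>[I]\<^sub>e = I \<inter> [C]\<^sub>e\<close>
because the coaction on \<open>I\<close> is the restriction of the one on \<open>C\<close>. Therefore covariance means exactly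
that \<open>t(A) \<inter> I = 0\<close>.

This argument needs that \<open>I\<close> is a linear subspace of \<open>C\<close> (\<open>covariance_ideal_subspace\<close>), and hence that the
homomorphism \<open>t\<^sub>*\<close> on the Toeplitz algebra exists (\<open>toeplitz_universal\<close>). The Toeplitz algebra is the
completion of a free star-algebra in the supremum of all C*-seminorms compatible with the relations, so
the main point is that this supremum is finite (\<open>admissible_seminorms_bounded\<close>). By the C*-identity
\<open>N(\<xi>)\<^sup>2 = N(\<xi>\<^sup>* \<xi>)\<close> the seminorm of a generator is controlled by the C*-seminorm that \<open>N\<close> induces on
\<open>A\<close>, and every C*-seminorm on a C*-algebra is dominated by the norm (\<open>seminorm_le_norm\<close>):
a self-adjoint element \<open>a\<close> with \<open>\<parallel>a\<parallel> < 1\<close> is the real part of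
the unitary \<open>a + \<i> (1 - a\<^sup>2)\<^sup>1\<^sup>/\<^sup>2\<close> in the unitization, the square root being found by iteration, and
C*-seminorms are at most one on unitaries.
\<close>

section \<open>Complex vector spaces\<close>

context complex_vs
begin

declare zero_closed [simp] add_closed [simp] scale_closed [simp] add_zero [simp]
  scale_one [simp] add_neg [simp]

lemma add_left_commute:
  "\<lbrakk>x \<in> carrier V; y \<in> carrier V; z \<in> carrier V\<rbrakk> \<Longrightarrow> vadd V x (vadd V y z) = vadd V y (vadd V x z)"
  by (metis add_assoc add_commute)

lemmas add_ac = add_assoc add_commute add_left_commute

lemma zero_add [simp]: "x \<in> carrier V \<Longrightarrow> vadd V (vzero V) x = x"
  using add_commute add_zero zero_closed by metis

lemma neg_add_cancel [simp]:
  "\<lbrakk>x \<in> carrier V; y \<in> carrier V\<rbrakk> \<Longrightarrow> vadd V x (vadd V (vscale V (-1) x) y) = y"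
  by (metis add_assoc add_neg scale_closed zero_add)

lemma add_neg_cancel [simp]:
  "\<lbrakk>x \<in> carrier V; y \<in> carrier V\<rbrakk> \<Longrightarrow> vadd V (vscale V (-1) x) (vadd V x y) = y"
  using add_left_commute[of "vscale V (-1) x" x y] by simp

lemma add_left_cancel:
  "\<lbrakk>x \<in> carrier V; y \<in> carrier V; z \<in> carrier V; vadd V x y = vadd V x z\<rbrakk> \<Longrightarrow> y = z"
  by (metis add_neg_cancel)

lemma scale_zero_left [simp]: "x \<in> carrier V \<Longrightarrow> vscale V 0 x = vzero V"
  using add_left_cancel[of x "vscale V 0 x" "vzero V"] scale_add_left[of x 1 0] by simp

lemma scale_zero_right [simp]: "vscale V c (vzero V) = vzero V"
  by (metis mult_zero_right scale_scale scale_zero_left zero_closed)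

lemma sub_closed [simp]: "\<lbrakk>x \<in> carrier V; y \<in> carrier V\<rbrakk> \<Longrightarrow> vsub V x y \<in> carrier V"
  by (simp add: vsub_def)

lemma sub_self [simp]: "x \<in> carrier V \<Longrightarrow> vsub V x x = vzero V"
  by (simp add: vsub_def)

lemma sub_zero [simp]: "x \<in> carrier V \<Longrightarrow> vsub V x (vzero V) = x"
  by (simp add: vsub_def)

lemma add_sub_cancel [simp]: "\<lbrakk>x \<in> carrier V; y \<in> carrier V\<rbrakk> \<Longrightarrow> vadd V y (vsub V x y) = x"
  by (metis add_left_commute add_neg add_zero scale_closed vsub_def)

lemma add_sub_self [simp]: "\<lbrakk>x \<in> carrier V; y \<in> carrier V\<rbrakk> \<Longrightarrow> vsub V (vadd V x y) x = y"
  using add_commute[of y "vscale V (-1) x"] by (simp add: vsub_def add_assoc)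

lemma sub_eq_zero_iff: "\<lbrakk>x \<in> carrier V; y \<in> carrier V\<rbrakk> \<Longrightarrow> vsub V x y = vzero V \<longleftrightarrow> x = y"
  by (metis add_sub_cancel add_zero sub_self)

lemma sub_add_sub:
  "\<lbrakk>x \<in> carrier V; y \<in> carrier V; x' \<in> carrier V; y' \<in> carrier V\<rbrakk>
    \<Longrightarrow> vsub V (vadd V x y) (vadd V x' y') = vadd V (vsub V x x') (vsub V y y')"
  by (simp add: vsub_def scale_add_right add_ac)

lemma scale_sub:
  "\<lbrakk>x \<in> carrier V; y \<in> carrier V\<rbrakk> \<Longrightarrow> vscale V c (vsub V x y) = vsub V (vscale V c x) (vscale V c y)"
  by (simp add: vsub_def scale_add_right scale_scale)

lemma sub_swap: "\<lbrakk>x \<in> carrier V; y \<in> carrier V\<rbrakk> \<Longrightarrow> vsub V y x = vscale V (-1) (vsub V x y)"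
  by (simp add: vsub_def scale_add_right scale_scale add_commute)

lemma sub_split:
  "\<lbrakk>x \<in> carrier V; y \<in> carrier V; z \<in> carrier V\<rbrakk> \<Longrightarrow> vsub V x z = vadd V (vsub V x y) (vsub V y z)"
  by (simp add: vsub_def add_assoc)

lemma scale_half_double: "x \<in> carrier V \<Longrightarrow> vscale V (1/2) (vadd V x x) = x"
  using scale_add_left[of x "1/2" "1/2"] by (simp add: scale_add_right)

end

locale linear_subspace = complex_vs V for V :: "('a, 'm) cvs_scheme" +
  fixes J :: "'a set"
  assumes subset: "J \<subseteq> carrier V"
    and zero_mem: "vzero V \<in> J"
    and add_mem: "\<lbrakk>x \<in> J; y \<in> J\<rbrakk> \<Longrightarrow> vadd V x y \<in> J"
    and scale_mem: "x \<in> J \<Longrightarrow> vscale V c x \<in> J"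
begin

lemma mem_coset_iff:
  assumes "x \<in> carrier V"
  shows "y \<in> coset V J x \<longleftrightarrow> y \<in> carrier V \<and> vsub V y x \<in> J"
proof
  assume "y \<in> coset V J x"
  then obtain j where j: "j \<in> J" "y = vadd V x j" by (auto simp: coset_def)
  then have "vsub V y x = j"
    using assms subset by auto
  then show "y \<in> carrier V \<and> vsub V y x \<in> J" using j assms subset by auto
next
  assume "y \<in> carrier V \<and> vsub V y x \<in> J"
  then show "y \<in> coset V J x"
    unfolding coset_def using assms by (intro image_eqI[of _ _ "vsub V y x"]) auto
qed

lemma self_mem_coset: "x \<in> carrier V \<Longrightarrow> x \<in> coset V J x"
  by (simp add: mem_coset_iff zero_mem)

lemma coset_eq_iff:
  assumes x: "x \<in> carrier V" and y: "y \<in> carrier V"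
  shows "coset V J x = coset V J y \<longleftrightarrow> vsub V x y \<in> J"
proof
  assume "coset V J x = coset V J y"
  then show "vsub V x y \<in> J" using self_mem_coset[OF x] mem_coset_iff[OF y] by simp
next
  assume xy: "vsub V x y \<in> J"
  then have yx: "vsub V y x \<in> J" using scale_mem sub_swap[OF x y] by metis
  have "vsub V z x \<in> J \<longleftrightarrow> vsub V z y \<in> J" if "z \<in> carrier V" for z
    using that x y xy yx add_mem sub_split[of z x y] sub_split[of z y x] by metis
  then show "coset V J x = coset V J y" using x y by (auto simp: mem_coset_iff)
qed

end

section \<open>C*-seminorms and limits\<close>

lemma tendsto_null_comparison:
  fixes f g :: "'i \<Rightarrow> real"
  assumes "\<And>n. \<bar>f n\<bar> \<le> g n" "(g \<longlongrightarrow> 0) F"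
  shows "(f \<longlongrightarrow> 0) F"
proof (rule tendsto_0_le[OF assms(2), of f 1])
  have "norm (f n) \<le> norm (g n) * 1" for n using assms(1)[of n] by simp
  then show "\<forall>\<^sub>F n in F. norm (f n) \<le> norm (g n) * 1" by simp
qed

context star_algebra
begin

declare mult_closed [simp] star_closed [simp] star_star [simp]

lemma mult_zero_right [simp]: "x \<in> carrier A \<Longrightarrow> amult A x (vzero A) = vzero A"
  using mult_scale_right[of x "vzero A" 0] by simp

lemma mult_zero_left [simp]: "x \<in> carrier A \<Longrightarrow> amult A (vzero A) x = vzero A"
  using mult_scale_left[of "vzero A" x 0] by simp

lemma star_zero [simp]: "astar A (vzero A) = vzero A"
  using star_scale[of "vzero A" 0] by simp

lemma star_sub:
  "\<lbrakk>x \<in> carrier A; y \<in> carrier A\<rbrakk> \<Longrightarrow> astar A (vsub A x y) = vsub A (astar A x) (astar A y)"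
  by (simp add: vsub_def star_add star_scale)

lemma mult_sub_left:
  "\<lbrakk>x \<in> carrier A; y \<in> carrier A; z \<in> carrier A\<rbrakk>
    \<Longrightarrow> amult A (vsub A x y) z = vsub A (amult A x z) (amult A y z)"
  by (simp add: vsub_def mult_add_left mult_scale_left)

lemma mult_sub_right:
  "\<lbrakk>x \<in> carrier A; y \<in> carrier A; z \<in> carrier A\<rbrakk>
    \<Longrightarrow> amult A z (vsub A x y) = vsub A (amult A z x) (amult A z y)"
  by (simp add: vsub_def mult_add_right mult_scale_right)

lemma mult_sub_mult:
  assumes "x \<in> carrier A" "y \<in> carrier A" "x' \<in> carrier A" "y' \<in> carrier A"
  shows "vsub A (amult A x y) (amult A x' y')
    = vadd A (amult A (vsub A x x') y) (amult A x' (vsub A y y'))"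
  using assms sub_split[of "amult A x y" "amult A x' y" "amult A x' y'"]
  by (simp add: mult_sub_left mult_sub_right)

end

locale seminormed_algebra = star_algebra A for A :: "('a, 'm) staralg_scheme" +
  fixes N :: "'a \<Rightarrow> real"
  assumes cstar_seminorm: "cstar_seminorm A N"
begin

lemma norm_nonneg [simp]: "x \<in> carrier A \<Longrightarrow> 0 \<le> N x"
  and norm_add: "\<lbrakk>x \<in> carrier A; y \<in> carrier A\<rbrakk> \<Longrightarrow> N (vadd A x y) \<le> N x + N y"
  and norm_scale: "x \<in> carrier A \<Longrightarrow> N (vscale A c x) = cmod c * N x"
  and norm_mult: "\<lbrakk>x \<in> carrier A; y \<in> carrier A\<rbrakk> \<Longrightarrow> N (amult A x y) \<le> N x * N y"
  and norm_star_mult: "x \<in> carrier A \<Longrightarrow> N (amult A (astar A x) x) = (N x)\<^sup>2"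
  using cstar_seminorm unfolding cstar_seminorm_def by auto

lemma norm_zero [simp]: "N (vzero A) = 0"
  using norm_scale[of "vzero A" 0] by simp

lemma norm_star [simp]:
  assumes "x \<in> carrier A"
  shows "N (astar A x) = N x"
proof -
  have le: "N y \<le> N (astar A y)" if y: "y \<in> carrier A" for y
  proof -
    have "N y * N y \<le> N (astar A y) * N y"
      using norm_star_mult[OF y] norm_mult[of "astar A y" y] y by (simp add: power2_eq_square)
    then show ?thesis
      using y by (metis mult_le_cancel_right norm_nonneg order.order_iff_strict star_closed not_le)
  qed
  show ?thesis using le[of x] le[of "astar A x"] assms by simp
qed

lemma norm_sub_commute: "\<lbrakk>x \<in> carrier A; y \<in> carrier A\<rbrakk> \<Longrightarrow> N (vsub A x y) = N (vsub A y x)"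
  by (simp add: sub_swap[of x y] norm_scale)

lemma norm_sub_triangle:
  "\<lbrakk>x \<in> carrier A; y \<in> carrier A; z \<in> carrier A\<rbrakk>
    \<Longrightarrow> N (vsub A x z) \<le> N (vsub A x y) + N (vsub A y z)"
  using norm_add[of "vsub A x y" "vsub A y z"] by (simp add: sub_split[of x y z])

lemma norm_le_norm_sub: "\<lbrakk>x \<in> carrier A; y \<in> carrier A\<rbrakk> \<Longrightarrow> N x \<le> N y + N (vsub A x y)"
  using norm_add[of y "vsub A x y"] by simp

lemma norm_diff_le: "\<lbrakk>x \<in> carrier A; y \<in> carrier A\<rbrakk> \<Longrightarrow> \<bar>N x - N y\<bar> \<le> N (vsub A x y)"
  using norm_le_norm_sub[of x y] norm_le_norm_sub[of y x] norm_sub_commute[of x y] by simp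

lemma norm_eq_of_sub:
  "\<lbrakk>x \<in> carrier A; y \<in> carrier A; N (vsub A x y) = 0\<rbrakk> \<Longrightarrow> N x = N y"
  using norm_diff_le[of x y] by simp

lemma norm_add_sub_add:
  "\<lbrakk>x \<in> carrier A; y \<in> carrier A; x' \<in> carrier A; y' \<in> carrier A\<rbrakk>
    \<Longrightarrow> N (vsub A (vadd A x y) (vadd A x' y')) \<le> N (vsub A x x') + N (vsub A y y')"
  using norm_add[of "vsub A x x'" "vsub A y y'"] by (simp add: sub_add_sub)

lemma norm_mult_sub_mult:
  assumes "x \<in> carrier A" "y \<in> carrier A" "x' \<in> carrier A" "y' \<in> carrier A"
  shows "N (vsub A (amult A x y) (amult A x' y')) \<le> N (vsub A x x') * N y + N x' * N (vsub A y y')"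
proof -
  have "N (vsub A (amult A x y) (amult A x' y'))
      \<le> N (amult A (vsub A x x') y) + N (amult A x' (vsub A y y'))"
    using assms by (simp add: mult_sub_mult norm_add)
  also have "\<dots> \<le> N (vsub A x x') * N y + N x' * N (vsub A y y')"
    using assms by (intro add_mono norm_mult) auto
  finally show ?thesis .
qed

lemma norm_scale_sub: "\<lbrakk>x \<in> carrier A; y \<in> carrier A\<rbrakk>
    \<Longrightarrow> N (vsub A (vscale A c x) (vscale A c y)) = cmod c * N (vsub A x y)"
  by (metis norm_scale scale_sub sub_closed)

lemma norm_star_sub: "\<lbrakk>x \<in> carrier A; y \<in> carrier A\<rbrakk>
    \<Longrightarrow> N (vsub A (astar A x) (astar A y)) = N (vsub A x y)"
  by (metis norm_star star_sub sub_closed)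

lemma converges_const: "x \<in> carrier A \<Longrightarrow> seq_converges A N (\<lambda>n. x) x"
  by (simp add: seq_converges_def)

lemma converges_norm:
  assumes "\<And>n. s n \<in> carrier A" "x \<in> carrier A" "seq_converges A N s x"
  shows "(\<lambda>n. N (s n)) \<longlonglongrightarrow> N x"
proof -
  have "(\<lambda>n. N (s n) - N x) \<longlonglongrightarrow> 0"
    by (rule tendsto_null_comparison[OF norm_diff_le[OF assms(1,2)] assms(3)[unfolded seq_converges_def]])
  then show ?thesis using LIM_zero_iff by blast
qed

lemma converges_unique:
  assumes "\<And>n. s n \<in> carrier A" "x \<in> carrier A" "y \<in> carrier A"
    "seq_converges A N s x" "seq_converges A N s y"
  shows "N (vsub A x y) = 0"
proof -
  have "(\<lambda>n. N (vsub A (s n) x) + N (vsub A (s n) y)) \<longlonglongrightarrow> 0 + 0"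
    using assms unfolding seq_converges_def by (intro tendsto_add)
  moreover have "N (vsub A x y) \<le> N (vsub A (s n) x) + N (vsub A (s n) y)" for n
    using norm_sub_triangle[of x "s n" y] norm_sub_commute[of x "s n"] assms by simp
  ultimately have "N (vsub A x y) \<le> 0 + 0" by (intro LIMSEQ_le_const) auto
  then show ?thesis using assms(2,3) by (intro antisym) simp_all
qed

lemma converges_add:
  assumes "\<And>n. s n \<in> carrier A" "x \<in> carrier A" "\<And>n. s' n \<in> carrier A" "y \<in> carrier A"
    "seq_converges A N s x" "seq_converges A N s' y"
  shows "seq_converges A N (\<lambda>n. vadd A (s n) (s' n)) (vadd A x y)"
proof -
  have "(\<lambda>n. N (vsub A (s n) x) + N (vsub A (s' n) y)) \<longlonglongrightarrow> 0"
    using assms tendsto_add_zero unfolding seq_converges_def by blast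
  moreover have "\<bar>N (vsub A (vadd A (s n) (s' n)) (vadd A x y))\<bar>
      \<le> N (vsub A (s n) x) + N (vsub A (s' n) y)" for n
    using norm_add_sub_add[OF assms(1,3,2,4)] assms by simp
  ultimately show ?thesis
    unfolding seq_converges_def
    by (rule tendsto_null_comparison[rotated])
qed

lemma converges_scale:
  assumes "\<And>n. s n \<in> carrier A" "x \<in> carrier A" "seq_converges A N s x"
  shows "seq_converges A N (\<lambda>n. vscale A c (s n)) (vscale A c x)"
  using assms tendsto_mult_right_zero[of "\<lambda>n. N (vsub A (s n) x)" sequentially "cmod c"]
  unfolding seq_converges_def by (simp add: norm_scale_sub)

lemma converges_star:
  assumes "\<And>n. s n \<in> carrier A" "x \<in> carrier A" "seq_converges A N s x"
  shows "seq_converges A N (\<lambda>n. astar A (s n)) (astar A x)"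
  using assms unfolding seq_converges_def by (simp add: norm_star_sub)

lemma converges_mult:
  assumes "\<And>n. s n \<in> carrier A" "x \<in> carrier A" "\<And>n. s' n \<in> carrier A" "y \<in> carrier A"
    "seq_converges A N s x" "seq_converges A N s' y"
  shows "seq_converges A N (\<lambda>n. amult A (s n) (s' n)) (amult A x y)"
proof -
  have "(\<lambda>n. N (vsub A (s n) x) * N (s' n) + N x * N (vsub A (s' n) y)) \<longlonglongrightarrow> 0"
    using tendsto_mult[OF assms(5)[unfolded seq_converges_def] converges_norm[OF assms(3,4,6)]]
      tendsto_mult[OF tendsto_const[of "N x"] assms(6)[unfolded seq_converges_def]]
    by (intro tendsto_add_zero) simp_all
  moreover have "\<bar>N (vsub A (amult A (s n) (s' n)) (amult A x y))\<bar>
      \<le> N (vsub A (s n) x) * N (s' n) + N x * N (vsub A (s' n) y)" for n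
    using norm_mult_sub_mult[OF assms(1,3,2,4)] assms by simp
  ultimately show ?thesis
    unfolding seq_converges_def
    by (rule tendsto_null_comparison[rotated])
qed

lemma cauchy_of_geometric:
  assumes s: "\<And>n. s n \<in> carrier A" and q: "0 \<le> q" "q < 1"
    and step: "\<And>n. N (vsub A (s (Suc n)) (s n)) \<le> q ^ n"
  shows "seq_cauchy A N s"
proof -
  have tail: "N (vsub A (s (n + k)) (s n)) \<le> (q ^ n - q ^ (n + k)) / (1 - q)" for n k
  proof (induction k)
    case 0
    then show ?case using s by simp
  next
    case (Suc k)
    have "N (vsub A (s (Suc (n + k))) (s n)) \<le> q ^ (n + k) + (q ^ n - q ^ (n + k)) / (1 - q)"
      using norm_sub_triangle[of "s (Suc (n + k))" "s (n + k)" "s n"] step[of "n + k"] Suc s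
      by simp
    also have "\<dots> = (q ^ n - q ^ (n + Suc k)) / (1 - q)"
      using q by (simp add: field_simps)
    finally show ?case by simp
  qed
  have lim: "(\<lambda>n. q ^ n / (1 - q)) \<longlonglongrightarrow> 0"
    using q by (intro tendsto_divide_zero LIMSEQ_power_zero) auto
  show ?thesis
    unfolding seq_cauchy_def
  proof (intro allI impI)
    fix \<epsilon> :: real
    assume "\<epsilon> > 0"
    then obtain M where M: "\<And>n. n \<ge> M \<Longrightarrow> q ^ n / (1 - q) < \<epsilon>"
      using order_tendstoD(2)[OF lim] by (auto simp: eventually_sequentially)
    have le: "N (vsub A (s m) (s n)) < \<epsilon>" if "M \<le> n" "n \<le> m" for m n
    proof -
      have "N (vsub A (s m) (s n)) \<le> (q ^ n - q ^ m) / (1 - q)"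
        using tail[of n "m - n"] that by simp
      also have "\<dots> \<le> q ^ n / (1 - q)" using q by (intro divide_right_mono) auto
      finally show ?thesis using M[of n] that by simp
    qed
    show "\<exists>M. \<forall>m\<ge>M. \<forall>n\<ge>M. N (vsub A (s m) (s n)) < \<epsilon>"
      using le norm_sub_commute[OF s s] by (metis nle_le)
  qed
qed

end

sublocale cstar_algebra \<subseteq> seminormed_algebra A "anorm A"
  by unfold_locales (rule seminorm)

context cstar_algebra
begin

lemma limit_unique:
  assumes "\<And>n. s n \<in> carrier A" "x \<in> carrier A" "y \<in> carrier A"
    "seq_converges A (anorm A) s x" "seq_converges A (anorm A) s y"
  shows "x = y"
  using converges_unique[OF assms] norm_definite assms sub_eq_zero_iff by (metis sub_closed)

section \<open>Contractivity of C*-seminorms\<close>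

text \<open>
The element \<open>c\<close> is \<open>1 - (1 - a\<^sup>2)\<^sup>1\<^sup>/\<^sup>2\<close>, written without a unit: the last equation says
\<open>a\<^sup>2 = 2 c - c\<^sup>2\<close>. It is the fixed point of \<open>x \<mapsto> (a\<^sup>2 + x\<^sup>2) / 2\<close>, which maps the ball of radius
\<open>q = \<parallel>a\<parallel>\<^sup>2 < 1\<close> into itself, as \<open>(q + q\<^sup>2) / 2 \<le> q\<close>, and contracts distances there by the factor \<open>q\<close>.
The iteration starts at \<open>0\<close> and only uses \<open>a\<^sup>2\<close>, so that every iterate is self-adjoint and commutes
with \<open>a\<close>; both properties pass to the limit.
\<close>

lemma one_minus_square_has_root:
  assumes a: "a \<in> carrier A" "astar A a = a" and less: "anorm A a < 1"
  obtains c where "c \<in> carrier A" "astar A c = c" "amult A a c = amult A c a"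
    "vadd A c c = vadd A (amult A a a) (amult A c c)"
proof -
  define p where "p = amult A a a"
  define q where "q = anorm A p"
  define c where "c = rec_nat (vzero A) (\<lambda>_ x. vscale A (1/2) (vadd A p (amult A x x)))"
  have c_simps: "c 0 = vzero A" "c (Suc n) = vscale A (1/2) (vadd A p (amult A (c n) (c n)))" for n
    by (simp_all add: c_def)
  have p [simp]: "p \<in> carrier A" "astar A p = p" "amult A a p = amult A p a"
    using a by (simp_all add: p_def star_mult mult_assoc)
  have q: "0 \<le> q" "q < 1"
    using a less norm_star_mult[OF a(1)] by (auto simp: q_def p_def power_less_one_iff)
  have cc [simp]: "c n \<in> carrier A" for n by (induction n) (simp_all add: c_simps)
  have c_star: "astar A (c n) = c n" for n
    by (induction n) (simp_all add: c_simps star_scale star_add star_mult)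
  have c_comm: "amult A a (c n) = amult A (c n) a" for n
  proof (induction n)
    case (Suc n)
    have "amult A a (amult A (c n) (c n)) = amult A (amult A (c n) (c n)) a"
      using a(1) Suc cc mult_assoc by metis
    then show ?case
      using a(1) by (simp add: c_simps mult_scale_left mult_scale_right mult_add_left mult_add_right)
  qed (simp add: c_simps a)
  have c_bound: "anorm A (c n) \<le> q" for n
  proof (induction n)
    case (Suc n)
    have "anorm A (amult A (c n) (c n)) \<le> anorm A (c n) * anorm A (c n)" by (simp add: norm_mult)
    also have "\<dots> \<le> q * 1" using Suc q by (intro mult_mono) auto
    finally show ?case
      using norm_add[of p "amult A (c n) (c n)"] by (simp add: c_simps norm_scale q_def)
  qed (simp add: c_simps q)
  have step: "anorm A (vsub A (c (Suc n)) (c n)) \<le> q ^ n" for n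
  proof (induction n)
    case 0
    have "anorm A (c 1) \<le> 1" using c_bound[of 1] q by simp
    then show ?case by (simp add: c_simps)
  next
    case (Suc n)
    let ?d = "anorm A (vsub A (c (Suc n)) (c n))"
    have "anorm A (vsub A (c (Suc (Suc n))) (c (Suc n)))
        = 1/2 * anorm A (vsub A (vadd A p (amult A (c (Suc n)) (c (Suc n)))) (vadd A p (amult A (c n) (c n))))"
      by (subst c_simps(2)[of "Suc n"], subst (3) c_simps(2)[of n], subst norm_scale_sub) simp_all
    also have "\<dots> \<le> 1/2 * (?d * anorm A (c (Suc n)) + anorm A (c n) * ?d)"
      using norm_add_sub_add[of p "amult A (c (Suc n)) (c (Suc n))" p "amult A (c n) (c n)"]
        norm_mult_sub_mult[of "c (Suc n)" "c (Suc n)" "c n" "c n"] by simp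
    also have "\<dots> \<le> 1/2 * (?d * q + q * ?d)"
      using q c_bound by (intro mult_left_mono add_mono mult_mono) auto
    also have "\<dots> \<le> q ^ Suc n" using Suc q by (simp add: mult_left_mono)
    finally show ?case .
  qed
  have "seq_cauchy A (anorm A) c" by (rule cauchy_of_geometric[OF cc q step])
  then obtain d where d [simp]: "d \<in> carrier A" and lim: "seq_converges A (anorm A) c d"
    using complete unfolding norm_complete_def by (metis cc image_subsetI)
  have lim_Suc: "seq_converges A (anorm A) (\<lambda>n. c (Suc n)) d"
    using LIMSEQ_Suc[OF lim[unfolded seq_converges_def]] by (simp add: seq_converges_def)
  have "seq_converges A (anorm A) (\<lambda>n. vscale A (1/2) (vadd A p (amult A (c n) (c n))))
      (vscale A (1/2) (vadd A p (amult A d d)))"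
    using lim by (intro converges_scale converges_add converges_mult converges_const) auto
  then have fixpoint: "d = vscale A (1/2) (vadd A p (amult A d d))"
    using lim_Suc by (intro limit_unique[of "\<lambda>n. c (Suc n)"]) (simp_all add: c_simps)
  show thesis
  proof
    show "astar A d = d"
      using converges_star[OF cc d lim] lim c_star by (intro limit_unique[of c]) simp_all
    show "amult A a d = amult A d a"
      using a lim converges_mult[of "\<lambda>n. a" a c d] converges_mult[of c d "\<lambda>n. a" a] c_comm
      by (intro limit_unique[of "\<lambda>n. amult A a (c n)"]) (simp_all add: converges_const)
    have "vadd A d d = vscale A (1/2 + 1/2) (vadd A p (amult A d d))"
      by (subst (1 2) fixpoint) (subst scale_add_left, simp_all)
    then show "vadd A d d = vadd A (amult A a a) (amult A d d)" using a(1) by (simp add: p_def)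
  qed (rule d)
qed

text \<open>
With \<open>c\<close> as in the previous lemma and a formal unit, \<open>u = a + \<i> (1 - c)\<close> is unitary. Multiplying by \<open>a\<close>
avoids the unit: \<open>w = u a = a\<^sup>2 + \<i> b\<close> with \<open>b = a - c a\<close> satisfies \<open>w\<^sup>* w = a\<^sup>2\<close>, hence \<open>N w = N a\<close> by the
C*-identity, and \<open>a\<^sup>2\<close> is the mean of \<open>w\<close> and \<open>w\<^sup>*\<close>, hence \<open>(N a)\<^sup>2 = N (a\<^sup>2) \<le> N w = N a\<close>.
\<close>

lemma seminorm_selfadjoint_le_1:
  assumes N: "cstar_seminorm A N" and a: "a \<in> carrier A" "astar A a = a" and less: "anorm A a < 1"
  shows "N a \<le> 1"
proof -
  interpret N: seminormed_algebra A N by unfold_locales (rule N)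
  obtain c where c [simp]: "c \<in> carrier A" and c_star: "astar A c = c"
    and ac: "amult A a c = amult A c a" and root: "vadd A c c = vadd A (amult A a a) (amult A c c)"
    using one_minus_square_has_root[OF a less] .
  define p where "p = amult A a a"
  define b where "b = vsub A a (amult A c a)"
  define w where "w = vadd A p (vscale A \<i> b)"
  note [simp] = a(1)
  have p [simp]: "p \<in> carrier A" and p_star: "astar A p = p" and cp: "amult A p c = amult A c p"
    using a ac by (simp_all add: p_def star_mult mult_assoc) (metis a(1) c mult_assoc)
  have b [simp]: "b \<in> carrier A" and b_star: "astar A b = b"
    using a ac c_star by (simp_all add: b_def star_sub star_mult)
  have w [simp]: "w \<in> carrier A" by (simp add: w_def)
  have w_star: "astar A w = vadd A p (vscale A (-\<i>) b)"
    by (simp add: w_def star_add star_scale p_star b_star)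
  have ab: "amult A a b = amult A b a"
    by (simp add: b_def mult_sub_left mult_sub_right) (metis a(1) ac c mult_assoc)
  have pb: "amult A p b = amult A b p"
    unfolding p_def using ab by (metis a(1) b mult_assoc)
  have cb: "amult A c b = amult A b c"
    by (simp add: b_def mult_sub_left mult_sub_right ac) (metis a(1) ac c mult_assoc)
  have ba: "vadd A (amult A b a) (amult A c p) = p"
    by (simp add: b_def mult_sub_left mult_assoc p_def add_commute)
  have root_p: "vadd A (amult A p p) (amult A c (amult A c p)) = vadd A (amult A c p) (amult A c p)"
    using arg_cong[OF root, of "\<lambda>x. amult A x p"] by (simp add: mult_add_left mult_assoc flip: p_def)
  have bb: "vadd A (amult A b b) (amult A c (amult A b a)) = amult A b a"
  proof -
    have "amult A c (amult A b a) = amult A b (amult A c a)"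
      using cb by (metis a(1) b c mult_assoc)
    then show ?thesis
      by (subst (2) b_def) (simp add: mult_sub_right add_commute)
  qed
  (* b b = p - p p, obtained by adding c p on both sides so that no subtraction has to be expanded *)
  have "vadd A (amult A c p) (vadd A (amult A b b) (amult A p p))
      = vadd A (vadd A (amult A b b) (amult A c (amult A b a)))
          (vadd A (amult A p p) (amult A c (amult A c p)))"
    by (subst (1) ba[symmetric]) (simp add: mult_add_right add_ac)
  also have "\<dots> = vadd A (amult A c p) (vadd A (amult A b a) (amult A c p))"
    unfolding bb root_p by (simp add: add_left_commute)
  finally have bb_pp: "vadd A (amult A b b) (amult A p p) = p"
    unfolding ba by (rule add_left_cancel[rotated 3]) simp_all
  have cancel: "vadd A (vscale A \<i> x) (vscale A (-\<i>) x) = vzero A" if "x \<in> carrier A" for x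
    using that scale_add_left[of x \<i> "-\<i>"] by simp
  have "amult A (astar A w) w
      = vadd A (vadd A (amult A b b) (amult A p p))
          (vadd A (vscale A \<i> (amult A p b)) (vscale A (-\<i>) (amult A p b)))"
    unfolding w_star unfolding w_def
    by (simp add: mult_add_left mult_add_right mult_scale_left mult_scale_right scale_scale
        scale_add_right pb add_ac)
  then have "amult A (astar A w) w = p" by (simp add: cancel bb_pp)
  then have Nw: "N w = N a"
    using N.norm_star_mult[OF w] N.norm_star_mult[OF a(1)] a(2)
    by (simp add: p_def power2_eq_iff_nonneg)
  have "vadd A w (astar A w)
      = vadd A (vadd A p p) (vadd A (vscale A \<i> b) (vscale A (-\<i>) b))"
    unfolding w_star unfolding w_def by (simp add: add_ac)
  then have "p = vscale A (1/2) (vadd A w (astar A w))"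
    by (simp add: cancel scale_half_double)
  then have "N p \<le> N w"
    using N.norm_add[of w "astar A w"] by (simp add: N.norm_scale)
  then have "N a * N a \<le> 1 * N a"
    using N.norm_star_mult[OF a(1)] a(2) Nw by (simp add: p_def power2_eq_square)
  then show ?thesis
    using less_le[of 0 "N a"] by (cases "N a = 0") (simp_all add: mult_le_cancel_right2)
qed

text \<open>
By the C*-identity it is enough to bound \<open>N\<close> on \<open>x\<^sup>* x\<close>, and after dividing by any \<open>r > \<parallel>x\<parallel>\<^sup>2\<close> this is
a self-adjoint element of norm less than one.
\<close>

lemma seminorm_le_norm:
  assumes N: "cstar_seminorm A N" and x: "x \<in> carrier A"
  shows "N x \<le> anorm A x"
proof -
  interpret N: seminormed_algebra A N by unfold_locales (rule N)
  have "(N x)\<^sup>2 \<le> r" if r: "(anorm A x)\<^sup>2 < r" for r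
  proof -
    have r0: "0 < r" using r by (smt (verit) zero_le_power2)
    let ?a = "vscale A (of_real (1/r)) (amult A (astar A x) x)"
    have "N ?a \<le> 1"
      using x r r0 by (intro seminorm_selfadjoint_le_1 N)
        (simp_all add: star_scale star_mult norm_scale norm_star_mult norm_divide)
    then show ?thesis
      using x r0 by (simp add: N.norm_scale N.norm_star_mult norm_divide)
  qed
  then have "(N x)\<^sup>2 \<le> (anorm A x)\<^sup>2" by (rule dense_ge)
  then show ?thesis using x by (simp add: power2_le_iff_abs_le)
qed

end

section \<open>Quotients and completions\<close>

text \<open>
Algebraic ideals, as the one of interest consists of the null sequences among the Cauchy sequences.
Invariance under the involution lets the star operation descend to cosets.
\<close>

locale star_ideal = star_algebra A + linear_subspace A J
  for A :: "('a, 'm) cstar_scheme" and J :: "'a set" +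
  assumes mult_mem_left: "\<lbrakk>x \<in> carrier A; y \<in> J\<rbrakk> \<Longrightarrow> amult A x y \<in> J"
    and mult_mem_right: "\<lbrakk>x \<in> carrier A; y \<in> J\<rbrakk> \<Longrightarrow> amult A y x \<in> J"
    and star_mem: "y \<in> J \<Longrightarrow> astar A y \<in> J"
begin

lemma UN_coset_unary:
  assumes x: "x \<in> carrier A" and f: "\<And>y. y \<in> carrier A \<Longrightarrow> f y \<in> carrier A"
    and J: "\<And>y. \<lbrakk>y \<in> carrier A; vsub A y x \<in> J\<rbrakk> \<Longrightarrow> vsub A (f y) (f x) \<in> J"
  shows "(\<Union>y\<in>coset A J x. coset A J (f y)) = coset A J (f x)"
proof -
  have "coset A J (f y) = coset A J (f x)" if "y \<in> coset A J x" for y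
    using that x f J by (simp add: coset_eq_iff mem_coset_iff)
  then show ?thesis using self_mem_coset[OF x] by blast
qed

lemma UN_coset_binary:
  assumes x: "x \<in> carrier A" "x' \<in> carrier A"
    and f: "\<And>y y'. \<lbrakk>y \<in> carrier A; y' \<in> carrier A\<rbrakk> \<Longrightarrow> f y y' \<in> carrier A"
    and J: "\<And>y y'. \<lbrakk>y \<in> carrier A; vsub A y x \<in> J; y' \<in> carrier A; vsub A y' x' \<in> J\<rbrakk>
      \<Longrightarrow> vsub A (f y y') (f x x') \<in> J"
  shows "(\<Union>y\<in>coset A J x. \<Union>y'\<in>coset A J x'. coset A J (f y y')) = coset A J (f x x')"
proof -
  have "coset A J (f y y') = coset A J (f x x')" if "y \<in> coset A J x" "y' \<in> coset A J x'" for y y'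
    using that x f J by (simp add: coset_eq_iff mem_coset_iff)
  then show ?thesis using self_mem_coset[OF x(1)] self_mem_coset[OF x(2)] by blast
qed

lemma quotient_carrier: "carrier (quotient_alg A J) = coset A J ` carrier A"
  and quotient_zero: "vzero (quotient_alg A J) = coset A J (vzero A)"
  by (simp_all add: quotient_alg_def)

lemma quotient_add:
  "\<lbrakk>x \<in> carrier A; y \<in> carrier A\<rbrakk>
    \<Longrightarrow> vadd (quotient_alg A J) (coset A J x) (coset A J y) = coset A J (vadd A x y)"
  by (simp add: quotient_alg_def) (rule UN_coset_binary, auto simp: sub_add_sub add_mem)

lemma quotient_scale:
  "x \<in> carrier A \<Longrightarrow> vscale (quotient_alg A J) c (coset A J x) = coset A J (vscale A c x)"
  by (simp add: quotient_alg_def)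
     (rule UN_coset_unary, auto simp: scale_sub[symmetric] scale_mem)

lemma quotient_mult:
  "\<lbrakk>x \<in> carrier A; y \<in> carrier A\<rbrakk>
    \<Longrightarrow> amult (quotient_alg A J) (coset A J x) (coset A J y) = coset A J (amult A x y)"
  by (simp add: quotient_alg_def)
     (rule UN_coset_binary, auto simp: mult_sub_mult add_mem mult_mem_left mult_mem_right)

lemma quotient_star:
  "x \<in> carrier A \<Longrightarrow> astar (quotient_alg A J) (coset A J x) = coset A J (astar A x)"
  by (simp add: quotient_alg_def)
     (rule UN_coset_unary, auto simp: star_sub[symmetric] star_mem)

lemmas quotient_ops = quotient_zero quotient_add quotient_scale quotient_mult quotient_star

lemma quotient_star_algebra: "star_algebra (quotient_alg A J)"
  by unfold_locales
     (auto simp: quotient_carrier quotient_ops add_ac scale_scale scale_add_right scale_add_left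
        mult_assoc mult_add_left mult_add_right mult_scale_left mult_scale_right star_add star_scale
        star_mult)

end

lemma star_hom_sub:
  assumes "complex_vs A" "star_hom A C \<phi>" "x \<in> carrier A" "y \<in> carrier A"
  shows "\<phi> (vsub A x y) = vsub C (\<phi> x) (\<phi> y)"
proof -
  interpret complex_vs A by (rule assms)
  show ?thesis using assms(2-4) by (simp add: star_hom_def vsub_def)
qed

lemma star_hom_zero:
  assumes "complex_vs A" "complex_vs C" "star_hom A C \<phi>"
  shows "\<phi> (vzero A) = vzero C"
proof -
  interpret A: complex_vs A by (rule assms)
  interpret C: complex_vs C by (rule assms)
  have "\<phi> (vscale A 0 (vzero A)) = vscale C 0 (\<phi> (vzero A))"
    using assms(3) A.zero_closed unfolding star_hom_def by blast
  then show ?thesis using assms(3) by (simp add: star_hom_def)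
qed

lemma (in star_ideal) quotient_induced_hom:
  assumes C: "complex_vs C" and hom: "star_hom A C L" and ker: "\<And>x. x \<in> J \<Longrightarrow> L x = vzero C"
  obtains \<phi> where "star_hom (quotient_alg A J) C \<phi>" "\<And>x. x \<in> carrier A \<Longrightarrow> \<phi> (coset A J x) = L x"
proof -
  interpret C: complex_vs C by (rule C)
  define \<phi> where "\<phi> S = L (SOME x. x \<in> carrier A \<and> coset A J x = S)" for S
  have \<phi>: "\<phi> (coset A J x) = L x" if x: "x \<in> carrier A" for x
  proof -
    define y where "y = (SOME y. y \<in> carrier A \<and> coset A J y = coset A J x)"
    have y: "y \<in> carrier A" "coset A J y = coset A J x"
      using someI[of "\<lambda>y. y \<in> carrier A \<and> coset A J y = coset A J x"] x by (auto simp: y_def)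
    then have "vsub C (L y) (L x) = vzero C"
      using ker[of "vsub A y x"] x by (simp add: coset_eq_iff star_hom_sub[OF complex_vs_axioms hom])
    then show ?thesis
      using hom x y by (simp add: C.sub_eq_zero_iff \<phi>_def y_def[symmetric] star_hom_def)
  qed
  have "star_hom (quotient_alg A J) C \<phi>"
    using hom unfolding star_hom_def by (auto simp: quotient_carrier quotient_ops \<phi>)
  with \<phi> show thesis using that by blast
qed

context seminormed_algebra
begin

text \<open>
Cauchy sequences become null functions along a product filter, and so the limit rules for sums and
products apply to them.
\<close>

lemma seq_cauchy_iff_tendsto:
  assumes "\<And>n. s n \<in> carrier A"
  shows "seq_cauchy A N s \<longleftrightarrow>
    ((\<lambda>k. N (vsub A (s (fst k)) (s (snd k)))) \<longlongrightarrow> 0) (sequentially \<times>\<^sub>F sequentially)"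
proof -
  have "norm (N (vsub A (s m) (s n)) - 0) = N (vsub A (s m) (s n))" for m n
    using assms by simp
  then show ?thesis
    unfolding seq_cauchy_def tendsto_iff eventually_prod_sequentially dist_norm fst_conv snd_conv
    by (simp only:) blast
qed

lemma seq_cauchy_bounded:
  assumes s: "\<And>n. s n \<in> carrier A" and "seq_cauchy A N s"
  obtains K where "0 \<le> K" "\<And>n. N (s n) \<le> K"
proof -
  obtain M where M: "\<And>m n. \<lbrakk>m \<ge> M; n \<ge> M\<rbrakk> \<Longrightarrow> N (vsub A (s m) (s n)) < 1"
    using assms(2) unfolding seq_cauchy_def by (metis zero_less_one)
  define K where "K = Max ((\<lambda>n. N (s n)) ` {..M}) + 1"
  have le: "N (s n) \<le> K - 1" if "n \<le> M" for n
    using that by (simp add: K_def)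
  have "N (s n) \<le> K" for n
  proof (cases "n \<le> M")
    case False
    then show ?thesis
      using M[of n M] norm_le_norm_sub[OF s s, of n M] le[of M] by simp
  qed (use le[of n] in simp)
  moreover have "0 \<le> K" using le[of 0] norm_nonneg[OF s, of 0] by simp
  ultimately show thesis using that by blast
qed

lemma seq_cauchy_const: "x \<in> carrier A \<Longrightarrow> seq_cauchy A N (\<lambda>n. x)"
  by (simp add: seq_cauchy_def)

lemma seq_cauchy_add:
  assumes s: "\<And>n. s n \<in> carrier A" "\<And>n. s' n \<in> carrier A"
    and "seq_cauchy A N s" "seq_cauchy A N s'"
  shows "seq_cauchy A N (\<lambda>n. vadd A (s n) (s' n))"
proof -
  have bound: "\<bar>N (vsub A (vadd A (s m) (s' m)) (vadd A (s n) (s' n)))\<bar>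
      \<le> N (vsub A (s m) (s n)) + N (vsub A (s' m) (s' n))" for m n
    using norm_add_sub_add s by simp
  have "((\<lambda>k. N (vsub A (s (fst k)) (s (snd k))) + N (vsub A (s' (fst k)) (s' (snd k))))
      \<longlongrightarrow> 0) (sequentially \<times>\<^sub>F sequentially)"
    using assms by (intro tendsto_add_zero) (simp_all add: seq_cauchy_iff_tendsto)
  from tendsto_null_comparison[OF bound this] show ?thesis
    using s by (subst seq_cauchy_iff_tendsto) simp_all
qed

lemma seq_cauchy_scale:
  assumes "\<And>n. s n \<in> carrier A" "seq_cauchy A N s"
  shows "seq_cauchy A N (\<lambda>n. vscale A c (s n))"
  using assms by (simp add: seq_cauchy_iff_tendsto norm_scale_sub tendsto_mult_right_zero)

lemma seq_cauchy_star:
  assumes "\<And>n. s n \<in> carrier A" "seq_cauchy A N s"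
  shows "seq_cauchy A N (\<lambda>n. astar A (s n))"
  using assms by (simp add: seq_cauchy_def norm_star_sub)

lemma seq_cauchy_mult:
  assumes s: "\<And>n. s n \<in> carrier A" "\<And>n. s' n \<in> carrier A"
    and cauchy: "seq_cauchy A N s" "seq_cauchy A N s'"
  shows "seq_cauchy A N (\<lambda>n. amult A (s n) (s' n))"
proof -
  obtain K where K: "0 \<le> K" "\<And>n. N (s n) \<le> K" using seq_cauchy_bounded s(1) cauchy(1) by blast
  obtain K' where K': "0 \<le> K'" "\<And>n. N (s' n) \<le> K'" using seq_cauchy_bounded s(2) cauchy(2) by blast
  have bound: "\<bar>N (vsub A (amult A (s m) (s' m)) (amult A (s n) (s' n)))\<bar>
      \<le> N (vsub A (s m) (s n)) * K' + K * N (vsub A (s' m) (s' n))" for m n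
  proof -
    have "N (vsub A (amult A (s m) (s' m)) (amult A (s n) (s' n)))
        \<le> N (vsub A (s m) (s n)) * N (s' m) + N (s n) * N (vsub A (s' m) (s' n))"
      by (intro norm_mult_sub_mult s)
    also have "\<dots> \<le> N (vsub A (s m) (s n)) * K' + K * N (vsub A (s' m) (s' n))"
      using K K' s by (intro add_mono mult_mono) auto
    finally show ?thesis using s by simp
  qed
  have "((\<lambda>k. N (vsub A (s (fst k)) (s (snd k))) * K' + K * N (vsub A (s' (fst k)) (s' (snd k))))
      \<longlongrightarrow> 0) (sequentially \<times>\<^sub>F sequentially)"
    using cauchy s by (intro tendsto_add_zero tendsto_mult_left_zero tendsto_mult_right_zero)
      (simp_all add: seq_cauchy_iff_tendsto)
  from tendsto_null_comparison[OF bound this] show ?thesis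
    using s by (subst seq_cauchy_iff_tendsto) simp_all
qed

lemma cauchy_alg_simps:
  "s \<in> carrier (cauchy_alg A N) \<longleftrightarrow> (\<forall>n. s n \<in> carrier A) \<and> seq_cauchy A N s"
  "vadd (cauchy_alg A N) s s' = (\<lambda>n. vadd A (s n) (s' n))"
  "vzero (cauchy_alg A N) = (\<lambda>n. vzero A)"
  "vscale (cauchy_alg A N) c s = (\<lambda>n. vscale A c (s n))"
  "amult (cauchy_alg A N) s s' = (\<lambda>n. amult A (s n) (s' n))"
  "astar (cauchy_alg A N) s = (\<lambda>n. astar A (s n))"
  by (auto simp: cauchy_alg_def)

lemma cauchy_star_algebra: "star_algebra (cauchy_alg A N)"
  by unfold_locales
     (auto simp: cauchy_alg_simps seq_cauchy_const seq_cauchy_add seq_cauchy_scale seq_cauchy_mult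
        seq_cauchy_star add_assoc scale_scale scale_add_right scale_add_left mult_assoc mult_add_left
        mult_add_right mult_scale_left mult_scale_right star_add star_scale star_mult
        intro: add_commute)

lemma mem_null_seqs: "s \<in> null_seqs A N \<longleftrightarrow> (\<forall>n. s n \<in> carrier A) \<and> (\<lambda>n. N (s n)) \<longlonglongrightarrow> 0"
  by (auto simp: null_seqs_def)

lemma null_seq_cauchy:
  assumes "s \<in> null_seqs A N"
  shows "seq_cauchy A N s"
proof -
  have s: "s n \<in> carrier A" for n using assms by (simp add: mem_null_seqs)
  have bound: "\<bar>N (vsub A (s m) (s n))\<bar> \<le> N (s m) + N (s n)" for m n
    using norm_sub_triangle[of "s m" "vzero A" "s n"] norm_sub_commute[of "s n" "vzero A"] s by simp
  have lim: "(\<lambda>n. N (s n)) \<longlonglongrightarrow> 0" using assms by (simp add: mem_null_seqs)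
  have "((\<lambda>k. N (s (fst k)) + N (s (snd k))) \<longlongrightarrow> 0) (sequentially \<times>\<^sub>F sequentially)"
    by (intro tendsto_add_zero filterlim_compose[OF lim])
       (simp_all add: filterlim_def filtermap_fst_prod_filter filtermap_snd_prod_filter)
  from tendsto_null_comparison[OF bound this] show ?thesis
    using s by (subst seq_cauchy_iff_tendsto) simp_all
qed

text \<open>
Cauchy sequences are bounded, hence their products with null sequences are null.
\<close>

lemma null_seqs_ideal: "star_ideal (cauchy_alg A N) (null_seqs A N)"
proof -
  interpret Q: star_algebra "cauchy_alg A N" by (rule cauchy_star_algebra)
  have mult: "(\<lambda>n. N (amult A (s n) (s' n))) \<longlonglongrightarrow> 0"
    if s: "\<And>n. s n \<in> carrier A" "\<And>n. s' n \<in> carrier A" and K: "\<And>n. N (s n) \<le> K"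
      and lim: "(\<lambda>n. N (s' n)) \<longlonglongrightarrow> 0" for s s' K
  proof (rule tendsto_null_comparison[of _ "\<lambda>n. K * N (s' n)"])
    show "\<bar>N (amult A (s n) (s' n))\<bar> \<le> K * N (s' n)" for n
      using norm_mult[OF s, of n n] mult_right_mono[OF K, of "N (s' n)" n] s by simp
  qed (rule tendsto_mult_right_zero[OF lim])
  have mult_right: "(\<lambda>n. N (amult A (s' n) (s n))) \<longlonglongrightarrow> 0"
    if s: "\<And>n. s n \<in> carrier A" "\<And>n. s' n \<in> carrier A" and K: "\<And>n. N (s n) \<le> K"
      and lim: "(\<lambda>n. N (s' n)) \<longlonglongrightarrow> 0" for s s' K
  proof (rule tendsto_null_comparison[of _ "\<lambda>n. N (s' n) * K"])
    show "\<bar>N (amult A (s' n) (s n))\<bar> \<le> N (s' n) * K" for n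
      using norm_mult[OF s(2,1), of n n] mult_left_mono[OF K, of "N (s' n)" n] s by simp
  qed (rule tendsto_mult_left_zero[OF lim])
  have add: "(\<lambda>n. N (vadd A (s n) (s' n))) \<longlonglongrightarrow> 0"
    if s: "\<And>n. s n \<in> carrier A" "\<And>n. s' n \<in> carrier A"
      and lim: "(\<lambda>n. N (s n)) \<longlonglongrightarrow> 0" "(\<lambda>n. N (s' n)) \<longlonglongrightarrow> 0" for s s'
  proof (rule tendsto_null_comparison[of _ "\<lambda>n. N (s n) + N (s' n)"])
    show "\<bar>N (vadd A (s n) (s' n))\<bar> \<le> N (s n) + N (s' n)" for n
      using norm_add[OF s, of n n] s by simp
  qed (rule tendsto_add_zero[OF lim])
  show ?thesis
  proof
    show "null_seqs A N \<subseteq> carrier (cauchy_alg A N)"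
      using null_seq_cauchy by (auto simp: cauchy_alg_simps mem_null_seqs)
    show "vzero (cauchy_alg A N) \<in> null_seqs A N"
      by (simp add: cauchy_alg_simps mem_null_seqs)
    show "vadd (cauchy_alg A N) s s' \<in> null_seqs A N"
      if "s \<in> null_seqs A N" "s' \<in> null_seqs A N" for s s'
      using that add[of s s'] by (simp add: cauchy_alg_simps mem_null_seqs)
    show "vscale (cauchy_alg A N) c s \<in> null_seqs A N" if "s \<in> null_seqs A N" for c s
      using that by (simp add: cauchy_alg_simps mem_null_seqs norm_scale tendsto_mult_right_zero)
    show "astar (cauchy_alg A N) s \<in> null_seqs A N" if "s \<in> null_seqs A N" for s
      using that by (simp add: cauchy_alg_simps mem_null_seqs)
    fix s s'
    assume s: "s \<in> carrier (cauchy_alg A N)" and s': "s' \<in> null_seqs A N"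
    obtain K where K: "\<And>n. N (s n) \<le> K"
      using seq_cauchy_bounded s by (metis cauchy_alg_simps(1))
    show "amult (cauchy_alg A N) s s' \<in> null_seqs A N"
      using s s' mult[OF _ _ K] by (simp add: cauchy_alg_simps mem_null_seqs)
    show "amult (cauchy_alg A N) s' s \<in> null_seqs A N"
      using s s' mult_right[OF _ _ K] by (simp add: cauchy_alg_simps mem_null_seqs)
  qed
qed

lemma completion_star_algebra: "star_algebra (completion A N)"
  unfolding completion_def by (rule star_ideal.quotient_star_algebra[OF null_seqs_ideal])

text \<open>
A homomorphism dominated by \<open>N\<close> maps Cauchy sequences to Cauchy sequences. Taking limits in \<open>C\<close> gives a
homomorphism on the algebra of Cauchy sequences that vanishes on null sequences, and it descends to the
completion.
\<close>

lemma completion_induced_hom: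
  assumes C: "cstar_algebra C" and hom: "star_hom A C L"
    and le: "\<And>x. x \<in> carrier A \<Longrightarrow> anorm C (L x) \<le> N x"
  obtains \<phi> where "star_hom (completion A N) C \<phi>"
    "\<And>x. x \<in> carrier A \<Longrightarrow> \<phi> (to_completion A N x) = L x"
proof -
  interpret C: cstar_algebra C by (rule C)
  interpret Q: star_ideal "cauchy_alg A N" "null_seqs A N" by (rule null_seqs_ideal)
  have L [simp]: "L x \<in> carrier C" if "x \<in> carrier A" for x
    using hom that by (simp add: star_hom_def)
  have le_sub: "anorm C (vsub C (L x) (L y)) \<le> N (vsub A x y)"
    if "x \<in> carrier A" "y \<in> carrier A" for x y
    using le[of "vsub A x y"] that by (simp add: star_hom_sub[OF complex_vs_axioms hom])
  define \<Lambda> where "\<Lambda> s = (SOME y. y \<in> carrier C \<and> seq_converges C (anorm C) (\<lambda>n. L (s n)) y)" for s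
  have \<Lambda>: "\<Lambda> s \<in> carrier C" "seq_converges C (anorm C) (\<lambda>n. L (s n)) (\<Lambda> s)"
    if "s \<in> carrier (cauchy_alg A N)" for s
  proof -
    have s: "\<And>n. s n \<in> carrier A" "seq_cauchy A N s" using that by (auto simp: cauchy_alg_simps)
    then have "seq_cauchy C (anorm C) (\<lambda>n. L (s n))"
      unfolding seq_cauchy_def using le_sub[OF s(1) s(1)] by (meson order.strict_trans1)
    then have "\<exists>y. y \<in> carrier C \<and> seq_converges C (anorm C) (\<lambda>n. L (s n)) y"
      using C.complete s(1) unfolding norm_complete_def by (metis L image_subsetI)
    then have "\<Lambda> s \<in> carrier C \<and> seq_converges C (anorm C) (\<lambda>n. L (s n)) (\<Lambda> s)"
      unfolding \<Lambda>_def by (rule someI_ex)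
    then show "\<Lambda> s \<in> carrier C" "seq_converges C (anorm C) (\<lambda>n. L (s n)) (\<Lambda> s)" by auto
  qed
  have \<Lambda>_eq: "\<Lambda> s = y"
    if "s \<in> carrier (cauchy_alg A N)" "y \<in> carrier C" "seq_converges C (anorm C) (\<lambda>n. L (s n)) y" for s y
    using that \<Lambda>[OF that(1)] by (intro C.limit_unique[of "\<lambda>n. L (s n)"]) (auto simp: cauchy_alg_simps)
  have "star_hom (cauchy_alg A N) C \<Lambda>"
    unfolding star_hom_def
  proof (intro conjI ballI allI)
    fix s c
    assume s: "s \<in> carrier (cauchy_alg A N)"
    then have sA: "\<And>n. s n \<in> carrier A" by (simp add: cauchy_alg_simps)
    show "\<Lambda> s \<in> carrier C" using \<Lambda>(1)[OF s] .
    show "\<Lambda> (vscale (cauchy_alg A N) c s) = vscale C c (\<Lambda> s)"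
      using C.converges_scale[OF L[OF sA] \<Lambda>[OF s]] hom sA s
      by (intro \<Lambda>_eq Q.scale_closed[OF s]) (simp_all add: \<Lambda> cauchy_alg_simps(4) star_hom_def)
    show "\<Lambda> (astar (cauchy_alg A N) s) = astar C (\<Lambda> s)"
      using C.converges_star[OF L[OF sA] \<Lambda>[OF s]] hom sA s
      by (intro \<Lambda>_eq Q.star_closed[OF s]) (simp_all add: \<Lambda> cauchy_alg_simps(6) star_hom_def)
    fix s'
    assume s': "s' \<in> carrier (cauchy_alg A N)"
    then have s'A: "\<And>n. s' n \<in> carrier A" by (simp add: cauchy_alg_simps)
    show "\<Lambda> (vadd (cauchy_alg A N) s s') = vadd C (\<Lambda> s) (\<Lambda> s')"
      using C.converges_add[OF L[OF sA] \<Lambda>(1)[OF s] L[OF s'A] \<Lambda>(1)[OF s'] \<Lambda>(2)[OF s] \<Lambda>(2)[OF s']]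
        hom sA s'A s s'
      by (intro \<Lambda>_eq Q.add_closed[OF s s']) (simp_all add: \<Lambda> cauchy_alg_simps(2) star_hom_def)
    show "\<Lambda> (amult (cauchy_alg A N) s s') = amult C (\<Lambda> s) (\<Lambda> s')"
      using C.converges_mult[OF L[OF sA] \<Lambda>(1)[OF s] L[OF s'A] \<Lambda>(1)[OF s'] \<Lambda>(2)[OF s] \<Lambda>(2)[OF s']]
        hom sA s'A s s'
      by (intro \<Lambda>_eq Q.mult_closed[OF s s']) (simp_all add: \<Lambda> cauchy_alg_simps(5) star_hom_def)
  qed
  moreover have "\<Lambda> s = vzero C" if s: "s \<in> null_seqs A N" for s
  proof (rule \<Lambda>_eq)
    show "s \<in> carrier (cauchy_alg A N)" using s Q.subset by blast
    have sA: "\<And>n. s n \<in> carrier A" using s by (simp add: mem_null_seqs)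
    have bound: "\<bar>anorm C (vsub C (L (s n)) (vzero C))\<bar> \<le> N (s n)" for n
      using le[OF sA] sA by simp
    have "(\<lambda>n. N (s n)) \<longlonglongrightarrow> 0" using s by (simp add: mem_null_seqs)
    then show "seq_converges C (anorm C) (\<lambda>n. L (s n)) (vzero C)"
      unfolding seq_converges_def by (rule tendsto_null_comparison[OF bound])
  qed simp
  ultimately obtain \<phi> where \<phi>: "star_hom (completion A N) C \<phi>"
    "\<And>s. s \<in> carrier (cauchy_alg A N) \<Longrightarrow> \<phi> (coset (cauchy_alg A N) (null_seqs A N) s) = \<Lambda> s"
    using Q.quotient_induced_hom[OF C.complex_vs_axioms] unfolding completion_def by blast
  show thesis
  proof (rule that[OF \<phi>(1)])
    fix x
    assume x: "x \<in> carrier A"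
    then have const: "(\<lambda>n. x) \<in> carrier (cauchy_alg A N)"
      by (simp add: cauchy_alg_simps seq_cauchy_const)
    then show "\<phi> (to_completion A N x) = L x"
      using x C.converges_const[of "L x"] unfolding to_completion_def \<phi>(2)[OF const]
      by (intro \<Lambda>_eq) simp_all
  qed
qed

end

section \<open>Semigroup algebras\<close>

locale involutive_semigroup =
  fixes S :: "'s set" and m :: "'s \<Rightarrow> 's \<Rightarrow> 's" and st :: "'s \<Rightarrow> 's"
  assumes m_closed [simp]: "\<lbrakk>u \<in> S; v \<in> S\<rbrakk> \<Longrightarrow> m u v \<in> S"
    and m_assoc: "\<lbrakk>u \<in> S; v \<in> S; w \<in> S\<rbrakk> \<Longrightarrow> m (m u v) w = m u (m v w)"
    and st_closed [simp]: "u \<in> S \<Longrightarrow> st u \<in> S"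
    and st_st [simp]: "u \<in> S \<Longrightarrow> st (st u) = u"
    and st_m: "\<lbrakk>u \<in> S; v \<in> S\<rbrakk> \<Longrightarrow> st (m u v) = m (st v) (st u)"
begin

abbreviation W :: "('s \<Rightarrow> complex) staralg" where
  "W \<equiv> semigroup_alg S m st"

abbreviation supp :: "('s \<Rightarrow> complex) \<Rightarrow> 's set" where
  "supp f \<equiv> {s. f s \<noteq> 0}"

lemma carrier_iff: "f \<in> carrier W \<longleftrightarrow> finite (supp f) \<and> supp f \<subseteq> S"
  by (simp add: semigroup_alg_def)

lemma alg_simps:
  "vadd W f g = (\<lambda>s. f s + g s)" "vzero W = (\<lambda>s. 0)" "vscale W c f = (\<lambda>s. c * f s)"
  "astar W f = (\<lambda>s. if s \<in> S then cnj (f (st s)) else 0)"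
  by (simp_all add: semigroup_alg_def)

lemma mult_eq:
  assumes "finite F" "finite G" "supp f \<subseteq> F" "supp g \<subseteq> G"
  shows "amult W f g s = (\<Sum>u\<in>F. \<Sum>v\<in>G. if m u v = s then f u * g v else 0)"
proof -
  have "amult W f g s = (\<Sum>(u, v)\<in>{(u, v). f u \<noteq> 0 \<and> g v \<noteq> 0 \<and> m u v = s}. f u * g v)"
    by (simp add: semigroup_alg_def)
  also have "\<dots> = (\<Sum>(u, v)\<in>F \<times> G. if m u v = s then f u * g v else 0)"
    using assms by (intro sum.mono_neutral_cong_left) (auto split: if_splits)
  finally show ?thesis by (simp add: sum.cartesian_product)
qed

lemma basis_closed [simp]: "u \<in> S \<Longrightarrow> basis_elt u \<in> carrier W"
  by (simp add: carrier_iff basis_elt_def)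

lemma basis_mult: "amult W (basis_elt u) (basis_elt v) = basis_elt (m u v)"
proof
  fix s
  show "amult W (basis_elt u) (basis_elt v) s = basis_elt (m u v) s"
    by (subst mult_eq[of "{u}" "{v}"]) (auto simp: basis_elt_def)
qed

lemma basis_star: "u \<in> S \<Longrightarrow> astar W (basis_elt u) = basis_elt (st u)"
  by (auto simp: alg_simps basis_elt_def fun_eq_iff)

lemma alg_add_closed: "\<lbrakk>f \<in> carrier W; g \<in> carrier W\<rbrakk> \<Longrightarrow> vadd W f g \<in> carrier W"
proof -
  assume f: "f \<in> carrier W" and g: "g \<in> carrier W"
  have "supp (vadd W f g) \<subseteq> supp f \<union> supp g" by (auto simp: alg_simps)
  moreover have "finite (supp f \<union> supp g)" "supp f \<union> supp g \<subseteq> S"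
    using f g by (simp_all add: carrier_iff)
  ultimately show ?thesis unfolding carrier_iff by (meson finite_subset order_trans)
qed

lemma alg_scale_closed: "f \<in> carrier W \<Longrightarrow> vscale W c f \<in> carrier W"
  unfolding carrier_iff alg_simps by (auto intro: finite_subset[of _ "supp f"])

text \<open>
Linear identities on the semigroup algebra need to be checked on basis elements only. The algebra axioms
that involve products and the multiplicativity of linear extensions are obtained in this way, one
variable at a time.
\<close>

lemma alg_induct [consumes 1, case_names zero basis scale add]:
  assumes f: "f \<in> carrier W"
    and zero: "Q (vzero W)" and basis: "\<And>s. s \<in> S \<Longrightarrow> Q (basis_elt s)"
    and scale: "\<And>c f. \<lbrakk>f \<in> carrier W; Q f\<rbrakk> \<Longrightarrow> Q (vscale W c f)"
    and add: "\<And>f g. \<lbrakk>f \<in> carrier W; g \<in> carrier W; Q f; Q g\<rbrakk> \<Longrightarrow> Q (vadd W f g)"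
  shows "Q f"
proof -
  have "supp f \<subseteq> F \<Longrightarrow> Q f" if "finite F" "F \<subseteq> S" for F f
    using that
  proof (induction F arbitrary: f)
    case empty
    then have "f = vzero W" by (auto simp: alg_simps)
    then show ?case using zero by simp
  next
    case (insert s F)
    let ?g = "\<lambda>x. if x = s then 0 else f x"
    have g: "supp ?g \<subseteq> F" using insert.prems by auto
    then have "finite (supp ?g)" "supp ?g \<subseteq> S"
      using finite_subset[OF g insert.hyps(1)] subset_trans[OF g] insert.prems(2) by blast+
    then have "?g \<in> carrier W" unfolding carrier_iff by blast
    moreover have "Q ?g" using insert.IH[OF g] insert.prems(2) by blast
    moreover have "f = vadd W ?g (vscale W (f s) (basis_elt s))"
      by (auto simp: alg_simps basis_elt_def)
    ultimately show ?case
      using add[of ?g "vscale W (f s) (basis_elt s)"] basis[of s] scale[of "basis_elt s" "f s"]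
        insert.prems alg_scale_closed by simp
  qed
  from this[of "supp f" f] show ?thesis using f by (simp add: carrier_iff)
qed

lemma alg_mult_closed:
  assumes "f \<in> carrier W" "g \<in> carrier W"
  shows "amult W f g \<in> carrier W"
proof -
  have "supp (amult W f g) \<subseteq> (\<lambda>(u, v). m u v) ` (supp f \<times> supp g)"
  proof
    fix s
    assume "s \<in> supp (amult W f g)"
    then have "(\<Sum>u\<in>supp f. \<Sum>v\<in>supp g. if m u v = s then f u * g v else 0) \<noteq> 0"
      using mult_eq[of "supp f" "supp g" f g s] assms by (simp add: carrier_iff)
    then obtain u where u: "u \<in> supp f" "(\<Sum>v\<in>supp g. if m u v = s then f u * g v else 0) \<noteq> 0"
      using sum.not_neutral_contains_not_neutral by blast
    then obtain v where "v \<in> supp g" "(if m u v = s then f u * g v else 0) \<noteq> 0"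
      using sum.not_neutral_contains_not_neutral by blast
    with u show "s \<in> (\<lambda>(u, v). m u v) ` (supp f \<times> supp g)" by (auto split: if_splits)
  qed
  moreover have "finite ((\<lambda>(u, v). m u v) ` (supp f \<times> supp g))"
    "(\<lambda>(u, v). m u v) ` (supp f \<times> supp g) \<subseteq> S"
    using assms by (auto simp: carrier_iff subset_iff)
  ultimately show ?thesis unfolding carrier_iff by (meson finite_subset order_trans)
qed

lemma alg_star_closed:
  assumes "f \<in> carrier W"
  shows "astar W f \<in> carrier W"
proof -
  have "supp (astar W f) \<subseteq> st ` supp f"
    using st_st by (force simp: alg_simps split: if_splits)
  moreover have "supp (astar W f) \<subseteq> S" by (auto simp: alg_simps)
  ultimately show ?thesis
    using assms unfolding carrier_iff by (meson finite_imageI finite_subset)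
qed

lemma alg_mult_add_left:
  assumes "f \<in> carrier W" "g \<in> carrier W" "h \<in> carrier W"
  shows "amult W (vadd W f g) h = vadd W (amult W f h) (amult W g h)"
proof
  fix s
  have fin: "finite (supp f \<union> supp g)" "finite (supp h)" using assms by (auto simp: carrier_iff)
  have "supp (vadd W f g) \<subseteq> supp f \<union> supp g" by (auto simp: alg_simps)
  note eqs = mult_eq[OF fin this order.refl] mult_eq[OF fin Un_upper1 order.refl]
    mult_eq[OF fin Un_upper2 order.refl]
  show "amult W (vadd W f g) h s = vadd W (amult W f h) (amult W g h) s"
    by (simp add: alg_simps(1)[of "amult W f h"] eqs)
       (auto simp: alg_simps distrib_right if_distrib simp flip: sum.distrib intro!: sum.cong)
qed

lemma alg_mult_add_right:
  assumes "f \<in> carrier W" "g \<in> carrier W" "h \<in> carrier W"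
  shows "amult W h (vadd W f g) = vadd W (amult W h f) (amult W h g)"
proof
  fix s
  have fin: "finite (supp h)" "finite (supp f \<union> supp g)" using assms by (auto simp: carrier_iff)
  have "supp (vadd W f g) \<subseteq> supp f \<union> supp g" by (auto simp: alg_simps)
  note eqs = mult_eq[OF fin order.refl this] mult_eq[OF fin order.refl Un_upper1]
    mult_eq[OF fin order.refl Un_upper2]
  show "amult W h (vadd W f g) s = vadd W (amult W h f) (amult W h g) s"
    by (simp add: alg_simps(1)[of "amult W h f"] eqs)
       (auto simp: alg_simps distrib_left if_distrib simp flip: sum.distrib intro!: sum.cong)
qed

lemma alg_mult_scale:
  assumes "f \<in> carrier W" "g \<in> carrier W"
  shows "amult W (vscale W c f) g = vscale W c (amult W f g)"
    and "amult W f (vscale W c g) = vscale W c (amult W f g)"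
proof -
  have fin: "finite (supp f)" "finite (supp g)" using assms by (auto simp: carrier_iff)
  have sub: "supp (vscale W c f) \<subseteq> supp f" "supp (vscale W c g) \<subseteq> supp g" by (auto simp: alg_simps)
  show "amult W (vscale W c f) g = vscale W c (amult W f g)"
    by (rule ext, simp add: alg_simps(3)[of c "amult W f g"] mult_eq[OF fin sub(1) order.refl]
          mult_eq[OF fin order.refl order.refl])
       (auto simp: alg_simps sum_distrib_left intro!: sum.cong)
  show "amult W f (vscale W c g) = vscale W c (amult W f g)"
    by (rule ext, simp add: alg_simps(3)[of c "amult W f g"] mult_eq[OF fin order.refl sub(2)]
          mult_eq[OF fin order.refl order.refl])
       (auto simp: alg_simps sum_distrib_left intro!: sum.cong)
qed

lemma semigroup_star_algebra: "star_algebra W"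
proof -
  interpret complex_vs W
    by unfold_locales
       (auto simp: alg_add_closed alg_scale_closed, auto simp: alg_simps carrier_iff algebra_simps)
  note closed = alg_mult_closed alg_star_closed
  note bilinear = alg_mult_add_left alg_mult_add_right alg_mult_scale
  have zero: "amult W f (vzero W) = vzero W" "amult W (vzero W) f = vzero W"
    if "f \<in> carrier W" for f
    using alg_mult_scale[of f "vzero W" 0] alg_mult_scale[of "vzero W" f 0] that
    by (simp_all add: closed)
  have star_add: "astar W (vadd W f g) = vadd W (astar W f) (astar W g)" for f g
    by (auto simp: alg_simps)
  have star_scale: "astar W (vscale W c f) = vscale W (cnj c) (astar W f)" for c f
    by (auto simp: alg_simps)
  have star_zero: "astar W (vzero W) = vzero W" by (auto simp: alg_simps)
  have assoc: "amult W (amult W f g) h = amult W f (amult W g h)"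
    if f: "f \<in> carrier W" and g: "g \<in> carrier W" and h: "h \<in> carrier W" for f g h
  proof -
    have 1: "amult W (amult W (basis_elt u) (basis_elt v)) h = amult W (basis_elt u) (amult W (basis_elt v) h)"
      if "u \<in> S" "v \<in> S" for u v
      using h that by (induction rule: alg_induct) (simp_all add: zero closed basis_mult m_assoc bilinear)
    have 2: "amult W (amult W (basis_elt u) g) h = amult W (basis_elt u) (amult W g h)"
      if "u \<in> S" for u
      using g that by (induction rule: alg_induct) (simp_all add: zero closed 1 bilinear h)
    show ?thesis
      using f by (induction rule: alg_induct) (simp_all add: zero closed 2 bilinear g h)
  qed
  have star_mult: "astar W (amult W f g) = amult W (astar W g) (astar W f)"
    if f: "f \<in> carrier W" and g: "g \<in> carrier W" for f g
  proof -
    have 1: "astar W (amult W (basis_elt u) g) = amult W (astar W g) (astar W (basis_elt u))"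
      if "u \<in> S" for u
      using g that by (induction rule: alg_induct)
        (simp_all add: zero closed basis_mult basis_star st_m star_add star_scale star_zero bilinear)
    show ?thesis
      using f by (induction rule: alg_induct)
        (simp_all add: zero closed 1 star_add star_scale star_zero bilinear g)
  qed
  show ?thesis
    by unfold_locales
       (simp_all add: closed bilinear assoc star_add star_scale star_mult,
        auto simp: alg_simps carrier_iff fun_eq_iff)
qed

text \<open>
The universal property of the semigroup algebra. The extension is \<open>f \<mapsto> \<Sum>s. f(s) e(s)\<close>; the sum is a
finite product in the additive monoid of \<open>C\<close>, and additivity in \<open>f\<close> holds because the sum may be taken
over any finite set containing the support.
\<close>

lemma semigroup_alg_hom:
  assumes C: "star_algebra C" and e: "\<And>u. u \<in> S \<Longrightarrow> e u \<in> carrier C"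
    and e_mult: "\<And>u v. \<lbrakk>u \<in> S; v \<in> S\<rbrakk> \<Longrightarrow> e (m u v) = amult C (e u) (e v)"
    and e_star: "\<And>u. u \<in> S \<Longrightarrow> e (st u) = astar C (e u)"
  obtains L where "star_hom W C L" "\<And>u. u \<in> S \<Longrightarrow> L (basis_elt u) = e u"
proof -
  interpret W: star_algebra W by (rule semigroup_star_algebra)
  interpret C: star_algebra C by (rule C)
  let ?M = "\<lparr>carrier = carrier C, mult = vadd C, one = vzero C\<rparr>"
  interpret M: comm_monoid ?M
    by unfold_locales (simp_all add: C.add_ac)
  define L where "L f = finprod ?M (\<lambda>s. vscale C (f s) (e s)) (supp f)" for f
  have L_eq: "L f = finprod ?M (\<lambda>s. vscale C (f s) (e s)) F"
    if "finite F" "supp f \<subseteq> F" "F \<subseteq> S" for f F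
    unfolding L_def using that e by (intro M.finprod_mono_neutral_cong_left) auto
  have L_basis: "L (basis_elt u) = e u" if "u \<in> S" for u
    using that e by (subst L_eq[of "{u}"]) (auto simp: basis_elt_def)
  have L_zero: "L (vzero W) = vzero C" by (simp add: L_def alg_simps)
  have L_closed: "L f \<in> carrier C" if "f \<in> carrier W" for f
  proof -
    have "(\<lambda>s. vscale C (f s) (e s)) \<in> supp f \<rightarrow> carrier ?M"
      using that e by (auto simp: carrier_iff subset_iff)
    then show ?thesis using M.finprod_closed by (auto simp: L_def)
  qed
  have L_add: "L (vadd W f g) = vadd C (L f) (L g)" if f: "f \<in> carrier W" and g: "g \<in> carrier W" for f g
  proof -
    let ?F = "supp f \<union> supp g"
    have F: "finite ?F" "?F \<subseteq> S" using f g by (auto simp: carrier_iff)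
    have "L (vadd W f g)
        = finprod ?M (\<lambda>s. vadd C (vscale C (f s) (e s)) (vscale C (g s) (e s))) ?F"
      using F e by (subst L_eq[OF F(1) _ F(2)])
        (auto simp: alg_simps C.scale_add_left intro!: M.finprod_cong')
    also have "\<dots> = vadd C (L f) (L g)"
    proof -
      have "(\<lambda>s. vscale C (h s) (e s)) \<in> ?F \<rightarrow> carrier ?M" for h :: "'s \<Rightarrow> complex"
        using F(2) e by (auto simp: subset_iff)
      from M.finprod_multf[OF this this] show ?thesis
        by (subst (1 2) L_eq[OF F(1) _ F(2)]) auto
    qed
    finally show ?thesis .
  qed
  have L_scale: "L (vscale W c f) = vscale C c (L f)" if f: "f \<in> carrier W" for c f
  proof -
    have sum: "finprod ?M (\<lambda>s. vscale C c (vscale C (f s) (e s))) F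
        = vscale C c (finprod ?M (\<lambda>s. vscale C (f s) (e s)) F)" if "finite F" "F \<subseteq> S" for F
      using that
    proof (induction F)
      case (insert s F)
      then have "(\<lambda>s. vscale C (f s) (e s)) \<in> F \<rightarrow> carrier ?M" using e by auto
      from M.finprod_closed[OF this] show ?case
        using insert e by (subst (1 2) M.finprod_insert) (auto simp: C.scale_add_right)
    qed simp
    have F: "finite (supp f)" "supp f \<subseteq> S" using f by (auto simp: carrier_iff)
    have "L (vscale W c f) = finprod ?M (\<lambda>s. vscale C c (vscale C (f s) (e s))) (supp f)"
      using F e by (subst L_eq[OF F(1) _ F(2)])
        (auto simp: alg_simps C.scale_scale intro!: M.finprod_cong')
    then show ?thesis using sum[OF F] by (simp add: L_def)
  qed
  have L_star: "L (astar W f) = astar C (L f)" if "f \<in> carrier W" for f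
    using that by (induction rule: alg_induct)
      (simp_all add: basis_star L_basis L_zero L_add L_scale L_closed e e_star
        W.star_add W.star_scale C.star_add C.star_scale)
  have L_mult: "L (amult W f g) = amult C (L f) (L g)" if f: "f \<in> carrier W" and g: "g \<in> carrier W" for f g
  proof -
    have 1: "L (amult W (basis_elt u) g) = amult C (e u) (L g)" if "u \<in> S" for u
      using g that by (induction rule: alg_induct)
        (simp_all add: basis_mult L_basis L_zero L_add L_scale L_closed e e_mult
          alg_mult_add_right alg_mult_scale C.mult_add_right C.mult_scale_right)
    show ?thesis
      using f by (induction rule: alg_induct)
        (simp_all add: 1 L_basis L_zero L_add L_scale L_closed e g
          alg_mult_add_left alg_mult_scale C.mult_add_left C.mult_scale_left)
  qed
  show thesis
    by (rule that[of L]) (simp_all add: star_hom_def L_closed L_add L_scale L_mult L_star L_basis)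
qed

end

section \<open>The maximal C*-seminorm\<close>

text \<open>
The seminorms whose supremum is \<open>max_seminorm\<close>. This supremum is one of real numbers, hence it is
meaningful only where the admissible seminorms are bounded; boundedness is an assumption in this part.
\<close>

definition admissible_seminorm ::
  "('a, 'm) staralg_scheme \<Rightarrow> ('a \<times> 'a) set \<Rightarrow> ('a \<Rightarrow> real) \<Rightarrow> bool" where
  "admissible_seminorm A R N \<longleftrightarrow> cstar_seminorm A N \<and> (\<forall>(x, y)\<in>R. N (vsub A x y) = 0)"

context star_algebra
begin

context
  fixes R :: "('a \<times> 'a) set"
  assumes bounded: "\<And>x. x \<in> carrier A \<Longrightarrow> \<exists>K. \<forall>N. admissible_seminorm A R N \<longrightarrow> N x \<le> K"
begin

lemma le_max_seminorm:
  assumes "admissible_seminorm A R N" "x \<in> carrier A"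
  shows "N x \<le> max_seminorm A R x"
  unfolding max_seminorm_def
proof (rule cSup_upper)
  show "N x \<in> {N x |N. cstar_seminorm A N \<and> (\<forall>(y, z)\<in>R. N (vsub A y z) = 0)}"
    using assms(1) by (auto simp: admissible_seminorm_def)
  show "bdd_above {N x |N. cstar_seminorm A N \<and> (\<forall>(y, z)\<in>R. N (vsub A y z) = 0)}"
    using bounded[OF assms(2)] by (auto simp: bdd_above_def admissible_seminorm_def)
qed

lemma zero_admissible: "admissible_seminorm A R (\<lambda>x. 0)"
  by (auto simp: admissible_seminorm_def cstar_seminorm_def)

lemma max_seminorm_le:
  assumes "\<And>N. admissible_seminorm A R N \<Longrightarrow> N x \<le> K"
  shows "max_seminorm A R x \<le> K"
  unfolding max_seminorm_def
  by (rule cSup_least) (use zero_admissible assms in \<open>auto simp: admissible_seminorm_def\<close>)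

text \<open>
Each condition is an inequality that is preserved by suprema. Homogeneity follows from the inequality
\<open>M (c x) \<le> |c| M x\<close> by applying it to \<open>c\<close> and to its inverse; for the C*-identity, squaring commutes with
suprema of nonnegative numbers.
\<close>

lemma cstar_seminorm_max: "cstar_seminorm A (max_seminorm A R)"
proof -
  let ?M = "max_seminorm A R"
  have adm: "seminormed_algebra A N" if "admissible_seminorm A R N" for N
    using that star_algebra_axioms
    by (auto simp: admissible_seminorm_def seminormed_algebra_def seminormed_algebra_axioms_def)
  have nonneg: "0 \<le> ?M x" if "x \<in> carrier A" for x
    using le_max_seminorm[OF zero_admissible that] .
  have scale_le: "?M (vscale A c x) \<le> cmod c * ?M x" if x: "x \<in> carrier A" for c x
  proof (rule max_seminorm_le)
    fix N
    assume N: "admissible_seminorm A R N"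
    interpret N: seminormed_algebra A N by (rule adm[OF N])
    show "N (vscale A c x) \<le> cmod c * ?M x"
      using le_max_seminorm[OF N x] x by (simp add: N.norm_scale mult_left_mono)
  qed
  have scale: "?M (vscale A c x) = cmod c * ?M x" if x: "x \<in> carrier A" for c x
  proof (cases "c = 0")
    case True
    then show ?thesis using scale_le[OF x, of 0] nonneg[of "vscale A 0 x"] x by simp
  next
    case False
    then have "?M x \<le> cmod (inverse c) * ?M (vscale A c x)"
      using scale_le[of "vscale A c x" "inverse c"] x by (simp add: scale_scale)
    then have "cmod c * ?M x \<le> ?M (vscale A c x)"
      using False by (simp add: norm_divide field_simps)
    then show ?thesis using scale_le[OF x, of c] by simp
  qed
  have add: "?M (vadd A x y) \<le> ?M x + ?M y" if "x \<in> carrier A" "y \<in> carrier A" for x y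
  proof (rule max_seminorm_le)
    fix N
    assume N: "admissible_seminorm A R N"
    interpret N: seminormed_algebra A N by (rule adm[OF N])
    show "N (vadd A x y) \<le> ?M x + ?M y"
      using N.norm_add[OF that] le_max_seminorm[OF N that(1)] le_max_seminorm[OF N that(2)] by simp
  qed
  have mult: "?M (amult A x y) \<le> ?M x * ?M y" if "x \<in> carrier A" "y \<in> carrier A" for x y
  proof (rule max_seminorm_le)
    fix N
    assume N: "admissible_seminorm A R N"
    interpret N: seminormed_algebra A N by (rule adm[OF N])
    have "N x * N y \<le> ?M x * ?M y"
      using that nonneg le_max_seminorm[OF N] by (intro mult_mono) auto
    then show "N (amult A x y) \<le> ?M x * ?M y" using N.norm_mult[OF that] by simp
  qed
  have cstar: "?M (amult A (astar A x) x) = (?M x)\<^sup>2" if x: "x \<in> carrier A" for x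
  proof (rule antisym)
    have xx: "amult A (astar A x) x \<in> carrier A" using x by simp
    show "?M (amult A (astar A x) x) \<le> (?M x)\<^sup>2"
    proof (rule max_seminorm_le)
      fix N
      assume N: "admissible_seminorm A R N"
      interpret N: seminormed_algebra A N by (rule adm[OF N])
      show "N (amult A (astar A x) x) \<le> (?M x)\<^sup>2"
        using le_max_seminorm[OF N x] x by (simp add: N.norm_star_mult power_mono)
    qed
    have "?M x \<le> sqrt (?M (amult A (astar A x) x))"
    proof (rule max_seminorm_le)
      fix N
      assume N: "admissible_seminorm A R N"
      interpret N: seminormed_algebra A N by (rule adm[OF N])
      show "N x \<le> sqrt (?M (amult A (astar A x) x))"
        using le_max_seminorm[OF N xx] x by (simp add: N.norm_star_mult real_le_rsqrt)
    qed
    then show "(?M x)\<^sup>2 \<le> ?M (amult A (astar A x) x)"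
      using nonneg[OF x] nonneg[OF xx] by (metis power_mono real_sqrt_pow2)
  qed
  show ?thesis
    unfolding cstar_seminorm_def using nonneg add scale mult cstar by blast
qed

end

end

section \<open>Subalgebras, ideals and images\<close>

lemma closed_star_subalgebra:
  fixes B :: "('a, 'm) cstar_scheme"
  assumes B: "cstar_algebra B" and L: "closed_subspace B (anorm B) L"
    and mult: "\<And>x y. \<lbrakk>x \<in> L; y \<in> L\<rbrakk> \<Longrightarrow> amult B x y \<in> L"
    and star: "\<And>x. x \<in> L \<Longrightarrow> astar B x \<in> L"
  shows "cstar_algebra (B\<lparr>carrier := L\<rparr>)"
proof -
  interpret B: cstar_algebra B by (rule B)
  have sub: "L \<subseteq> carrier B" using L by (simp add: closed_subspace_def)
  then have mem: "x \<in> carrier B" if "x \<in> L" for x using that by blast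
  have vsub: "vsub (B\<lparr>carrier := L\<rparr>) = vsub B" by (simp add: vsub_def fun_eq_iff)
  show ?thesis
  proof unfold_locales
    show "norm_complete (B\<lparr>carrier := L\<rparr>) (anorm (B\<lparr>carrier := L\<rparr>))"
      unfolding norm_complete_def
    proof (intro allI impI)
      fix s
      assume "range s \<subseteq> carrier (B\<lparr>carrier := L\<rparr>) \<and>
        seq_cauchy (B\<lparr>carrier := L\<rparr>) (anorm (B\<lparr>carrier := L\<rparr>)) s"
      then have s: "range s \<subseteq> L" "seq_cauchy B (anorm B) s"
        by (simp_all add: seq_cauchy_def vsub)
      then obtain x where "x \<in> carrier B" "seq_converges B (anorm B) s x"
        using B.complete sub unfolding norm_complete_def by blast
      then have "x \<in> L \<and> seq_converges B (anorm B) s x"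
        using L s(1) unfolding closed_subspace_def by blast
      then show "\<exists>x\<in>carrier (B\<lparr>carrier := L\<rparr>).
          seq_converges (B\<lparr>carrier := L\<rparr>) (anorm (B\<lparr>carrier := L\<rparr>)) s x"
        by (auto simp: seq_converges_def vsub)
    qed
    show "cstar_seminorm (B\<lparr>carrier := L\<rparr>) (anorm (B\<lparr>carrier := L\<rparr>))"
      using B.seminorm mem by (simp add: cstar_seminorm_def)
  qed (use L in \<open>auto simp: closed_subspace_def mem mult star B.add_assoc B.scale_scale
      B.scale_add_right B.scale_add_left B.mult_assoc B.mult_add_left B.mult_add_right
      B.mult_scale_left B.mult_scale_right B.star_add B.star_scale B.star_mult
      intro: B.add_commute B.norm_definite\<close>)
qed

lemma (in cstar_algebra) cstar_generated_cstar_algebra: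
  assumes "S \<subseteq> carrier A"
  shows "cstar_algebra (A\<lparr>carrier := cstar_generated A S\<rparr>)" and "S \<subseteq> cstar_generated A S"
    and "cstar_generated A S \<subseteq> carrier A"
proof -
  have A: "closed_subspace A (anorm A) (carrier A)" by (simp add: closed_subspace_def)
  then show sub: "cstar_generated A S \<subseteq> carrier A"
    using assms by (auto simp: cstar_generated_def)
  show "S \<subseteq> cstar_generated A S" by (auto simp: cstar_generated_def)
  show "cstar_algebra (A\<lparr>carrier := cstar_generated A S\<rparr>)"
  proof (rule closed_star_subalgebra[OF cstar_algebra_axioms])
    show "closed_subspace A (anorm A) (cstar_generated A S)"
      unfolding closed_subspace_def
    proof (intro conjI)
      show "\<forall>s x. range s \<subseteq> cstar_generated A S \<and> x \<in> carrier A \<and> seq_converges A (anorm A) s x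
          \<longrightarrow> x \<in> cstar_generated A S"
      proof (intro allI impI)
        fix s x
        assume s: "range s \<subseteq> cstar_generated A S \<and> x \<in> carrier A \<and> seq_converges A (anorm A) s x"
        show "x \<in> cstar_generated A S"
          unfolding cstar_generated_def
        proof (rule InterI)
          fix L
          assume L: "L \<in> {L. closed_subspace A (anorm A) L \<and>
            (\<forall>x\<in>L. \<forall>y\<in>L. amult A x y \<in> L) \<and> (\<forall>x\<in>L. astar A x \<in> L) \<and> S \<subseteq> L}"
          then have "cstar_generated A S \<subseteq> L" unfolding cstar_generated_def by (rule Inter_lower)
          then have "range s \<subseteq> L" using s by (meson order_trans)
          moreover have "closed_subspace A (anorm A) L" using L by simp
          ultimately show "x \<in> L"
            using s unfolding closed_subspace_def by meson
        qed
      qed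
    qed (use sub in \<open>auto simp: cstar_generated_def closed_subspace_def\<close>)
  qed (auto simp: cstar_generated_def)
qed

lemma ideal_generated_subspace:
  assumes A: "star_algebra A" and S: "S \<subseteq> carrier A"
  shows "linear_subspace A (ideal_generated A S)"
proof -
  interpret star_algebra A by (rule A)
  have "closed_ideal A (carrier A)" by (simp add: closed_ideal_def closed_subspace_def)
  then have "ideal_generated A S \<subseteq> carrier A" using S by (auto simp: ideal_generated_def)
  then show ?thesis
    by unfold_locales (auto simp: ideal_generated_def closed_ideal_def closed_subspace_def)
qed

lemma star_hom_image_subspace:
  assumes J: "linear_subspace A J" and C: "complex_vs C" and hom: "star_hom A C \<phi>"
  shows "linear_subspace C (\<phi> ` J)"
proof -
  interpret J: linear_subspace A J by (rule J)
  interpret C: complex_vs C by (rule C)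
  have add: "\<phi> (vadd A x y) = vadd C (\<phi> x) (\<phi> y)" and scale: "\<phi> (vscale A c x) = vscale C c (\<phi> x)"
    and closed: "\<phi> x \<in> carrier C" if "x \<in> J" "y \<in> J" for x y c
    using hom that J.subset by (simp_all add: star_hom_def subset_iff)
  show ?thesis
  proof
    show "\<phi> ` J \<subseteq> carrier C" using closed by blast
    show "vzero C \<in> \<phi> ` J"
      using star_hom_zero[OF J.complex_vs_axioms C hom] J.zero_mem by force
    show "vadd C x y \<in> \<phi> ` J" if "x \<in> \<phi> ` J" "y \<in> \<phi> ` J" for x y
      using that J.add_mem by (auto simp flip: add)
    show "vscale C c x \<in> \<phi> ` J" if "x \<in> \<phi> ` J" for x c
      using that J.scale_mem by (auto simp flip: scale)
  qed
qed

lemma alg_ker_coset: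
  assumes "linear_subspace A J"
  shows "alg_ker A (quotient_alg A J) (coset A J) = J"
proof -
  interpret linear_subspace A J by (rule assms)
  have "coset A J x = coset A J (vzero A) \<longleftrightarrow> x \<in> J" if "x \<in> carrier A" for x
    using that by (simp add: coset_eq_iff)
  then show ?thesis
    using subset by (simp add: alg_ker_def quotient_alg_def set_eq_iff) blast
qed

section \<open>The Toeplitz algebra and its universal property\<close>

locale toeplitz_system =
  fixes H :: "('h, complex) ipspace" and P :: "('p, 'k) monoid_scheme"
    and X :: "'p \<Rightarrow> ('h \<Rightarrow> 'h) set"
  assumes product_system: "product_system H P X"
begin

abbreviation BH :: "('h \<Rightarrow> 'h) cstar" where "BH \<equiv> bounded_ops H"

text \<open>
The index semigroup and the involution behind \<open>free_alg\<close>, named so that the results on semigroup algebras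
apply to it.
\<close>

definition letter_words :: "('p, 'h \<Rightarrow> 'h) ps_word set" where
  "letter_words = {w. w \<noteq> [] \<and> (\<forall>(p, \<xi>, b)\<in>set w. p \<in> carrier P \<and> \<xi> \<in> X p)}"

definition adjoint_word :: "('p, 'h \<Rightarrow> 'h) ps_word \<Rightarrow> ('p, 'h \<Rightarrow> 'h) ps_word" where
  "adjoint_word w = rev (map (\<lambda>(p, \<xi>, b). (p, \<xi>, \<not> b)) w)"

end

sublocale toeplitz_system \<subseteq> involutive_semigroup letter_words "(@)" adjoint_word
  by unfold_locales
     (auto simp: letter_words_def adjoint_word_def rev_map comp_def split_beta intro!: map_idI)

context toeplitz_system
begin

lemma free_alg_eq: "free_alg P X = W"
  by (simp add: free_alg_def letter_words_def[abs_def] adjoint_word_def[abs_def])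

sublocale W: star_algebra W
  by (rule semigroup_star_algebra)

lemma one_closed: "\<one>\<^bsub>P\<^esub> \<in> carrier P" and r_one: "p \<in> carrier P \<Longrightarrow> p \<otimes>\<^bsub>P\<^esub> \<one>\<^bsub>P\<^esub> = p"
  and mult_closed: "\<lbrakk>p \<in> carrier P; q \<in> carrier P\<rbrakk> \<Longrightarrow> p \<otimes>\<^bsub>P\<^esub> q \<in> carrier P"
  using product_system by (auto simp: product_system_def monoid.one_closed monoid.r_one monoid.m_closed)

lemma fibre_add: "\<lbrakk>p \<in> carrier P; \<xi> \<in> X p; \<eta> \<in> X p\<rbrakk> \<Longrightarrow> vadd BH \<xi> \<eta> \<in> X p"
  and fibre_scale: "\<lbrakk>p \<in> carrier P; \<xi> \<in> X p\<rbrakk> \<Longrightarrow> vscale BH c \<xi> \<in> X p"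
  and fibre_mult: "\<lbrakk>p \<in> carrier P; q \<in> carrier P; \<xi> \<in> X p; \<eta> \<in> X q\<rbrakk>
    \<Longrightarrow> amult BH \<xi> \<eta> \<in> X (p \<otimes>\<^bsub>P\<^esub> q)"
  and fibre_star_mult: "\<lbrakk>p \<in> carrier P; q \<in> carrier P; \<xi> \<in> X p; \<zeta> \<in> X (p \<otimes>\<^bsub>P\<^esub> q)\<rbrakk>
    \<Longrightarrow> amult BH (astar BH \<xi>) \<zeta> \<in> X q"
  using product_system by (auto simp: product_system_def closed_subspace_def)

lemma coeff_cstar: "cstar_algebra (coeff_alg H P X)"
  using product_system by (simp add: product_system_def)

lemma coeff_simps:
  "carrier (coeff_alg H P X) = X \<one>\<^bsub>P\<^esub>" "vadd (coeff_alg H P X) = vadd BH"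
  "vscale (coeff_alg H P X) = vscale BH" "vzero (coeff_alg H P X) = vzero BH"
  "amult (coeff_alg H P X) = amult BH" "astar (coeff_alg H P X) = astar BH"
  by (simp_all add: coeff_alg_def)

lemma coeff_star: "a \<in> X \<one>\<^bsub>P\<^esub> \<Longrightarrow> astar BH a \<in> X \<one>\<^bsub>P\<^esub>"
  using star_algebra.star_closed[OF cstar_algebra.axioms(1)[OF coeff_cstar]] by (simp add: coeff_simps)

lemma free_gen_closed: "\<lbrakk>p \<in> carrier P; \<xi> \<in> X p\<rbrakk> \<Longrightarrow> free_gen p \<xi> \<in> carrier W"
  unfolding free_gen_def by (rule basis_closed) (simp add: letter_words_def)

lemma toeplitz_relation_add: "\<lbrakk>p \<in> carrier P; \<xi> \<in> X p; \<eta> \<in> X p\<rbrakk> \<Longrightarrow>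
    (free_gen p (vadd BH \<xi> \<eta>), vadd W (free_gen p \<xi>) (free_gen p \<eta>)) \<in> toeplitz_relations H P X"
  and toeplitz_relation_scale: "\<lbrakk>p \<in> carrier P; \<xi> \<in> X p\<rbrakk> \<Longrightarrow>
    (free_gen p (vscale BH c \<xi>), vscale W c (free_gen p \<xi>)) \<in> toeplitz_relations H P X"
  and toeplitz_relation_mult: "\<lbrakk>p \<in> carrier P; q \<in> carrier P; \<xi> \<in> X p; \<eta> \<in> X q\<rbrakk> \<Longrightarrow>
    (amult W (free_gen p \<xi>) (free_gen q \<eta>), free_gen (p \<otimes>\<^bsub>P\<^esub> q) (amult BH \<xi> \<eta>))
      \<in> toeplitz_relations H P X"
  and toeplitz_relation_star_mult: "\<lbrakk>p \<in> carrier P; q \<in> carrier P; \<xi> \<in> X p; \<zeta> \<in> X (p \<otimes>\<^bsub>P\<^esub> q)\<rbrakk> \<Longrightarrow>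
    (amult W (astar W (free_gen p \<xi>)) (free_gen (p \<otimes>\<^bsub>P\<^esub> q) \<zeta>),
      free_gen q (amult BH (astar BH \<xi>) \<zeta>)) \<in> toeplitz_relations H P X"
  unfolding toeplitz_relations_def Let_def free_alg_eq by blast+

context
  fixes N
  assumes N: "admissible_seminorm W (toeplitz_relations H P X) N"
begin

interpretation N: seminormed_algebra W N
  using N by unfold_locales (simp add: admissible_seminorm_def)

lemma norm_eq_of_relation:
  "\<lbrakk>(x, y) \<in> toeplitz_relations H P X; x \<in> carrier W; y \<in> carrier W\<rbrakk> \<Longrightarrow> N x = N y"
  using N by (intro N.norm_eq_of_sub) (auto simp: admissible_seminorm_def)

text \<open>
By the Toeplitz relations the generators of index \<open>e\<close> depend on \<open>a \<in> X\<^sub>e\<close> like a star-homomorphism, up to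
elements of seminorm zero, hence an admissible seminorm restricts to a C*-seminorm on \<open>X\<^sub>e\<close>.
\<close>

lemma coeff_seminorm: "cstar_seminorm (coeff_alg H P X) (\<lambda>a. N (free_gen \<one>\<^bsub>P\<^esub> a))"
proof -
  note closed = free_gen_closed[OF one_closed]
  have one: "\<one>\<^bsub>P\<^esub> \<otimes>\<^bsub>P\<^esub> \<one>\<^bsub>P\<^esub> = \<one>\<^bsub>P\<^esub>" using r_one one_closed by simp
  have mult: "amult BH a b \<in> X \<one>\<^bsub>P\<^esub>" if "a \<in> X \<one>\<^bsub>P\<^esub>" "b \<in> X \<one>\<^bsub>P\<^esub>" for a b
    using fibre_mult[OF one_closed one_closed that] by (simp add: one)
  show ?thesis
    unfolding cstar_seminorm_def coeff_simps
  proof (intro conjI ballI allI)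
    fix a b c
    assume a: "a \<in> X \<one>\<^bsub>P\<^esub>"
    show "0 \<le> N (free_gen \<one>\<^bsub>P\<^esub> a)" using closed[OF a] by simp
    show "N (free_gen \<one>\<^bsub>P\<^esub> (vscale BH c a)) = cmod c * N (free_gen \<one>\<^bsub>P\<^esub> a)"
      using norm_eq_of_relation[OF toeplitz_relation_scale[OF one_closed a]] closed[OF a]
        closed[OF fibre_scale[OF one_closed a]] by (simp add: N.norm_scale)
    show "N (free_gen \<one>\<^bsub>P\<^esub> (amult BH (astar BH a) a)) = (N (free_gen \<one>\<^bsub>P\<^esub> a))\<^sup>2"
      using norm_eq_of_relation[OF toeplitz_relation_star_mult[of "\<one>\<^bsub>P\<^esub>" "\<one>\<^bsub>P\<^esub>" a a]] one one_closed a
        closed[OF a] closed[OF mult[OF coeff_star[OF a] a]] by (simp add: N.norm_star_mult)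
    assume b: "b \<in> X \<one>\<^bsub>P\<^esub>"
    show "N (free_gen \<one>\<^bsub>P\<^esub> (vadd BH a b)) \<le> N (free_gen \<one>\<^bsub>P\<^esub> a) + N (free_gen \<one>\<^bsub>P\<^esub> b)"
      using norm_eq_of_relation[OF toeplitz_relation_add[OF one_closed a b]] closed[OF a] closed[OF b]
        closed[OF fibre_add[OF one_closed a b]] N.norm_add by simp
    show "N (free_gen \<one>\<^bsub>P\<^esub> (amult BH a b)) \<le> N (free_gen \<one>\<^bsub>P\<^esub> a) * N (free_gen \<one>\<^bsub>P\<^esub> b)"
      using norm_eq_of_relation[OF toeplitz_relation_mult[OF one_closed one_closed a b]] one
        N.norm_mult[OF closed[OF a] closed[OF b]] closed[OF a] closed[OF b] closed[OF mult[OF a b]] by simp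
  qed
qed

text \<open>
As \<open>\<xi>\<^sup>* \<xi>\<close> lies in \<open>X\<^sub>e\<close>, where admissible seminorms are contractive, the C*-identity bounds all admissible
seminorms at the generator \<open>\<xi>\<close> by a number independent of the seminorm.
\<close>

lemma norm_free_gen_le:
  assumes p: "p \<in> carrier P" and \<xi>: "\<xi> \<in> X p"
  shows "N (free_gen p \<xi>) \<le> sqrt (anorm (coeff_alg H P X) (amult BH (astar BH \<xi>) \<xi>))"
proof -
  have \<xi>\<xi>: "amult BH (astar BH \<xi>) \<xi> \<in> X \<one>\<^bsub>P\<^esub>"
    using fibre_star_mult[OF p one_closed \<xi>] \<xi> r_one[OF p] by simp
  have "(N (free_gen p \<xi>))\<^sup>2 = N (free_gen \<one>\<^bsub>P\<^esub> (amult BH (astar BH \<xi>) \<xi>))"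
    using norm_eq_of_relation[OF toeplitz_relation_star_mult[OF p one_closed \<xi>, of \<xi>]] \<xi> r_one[OF p]
      free_gen_closed[OF p \<xi>] free_gen_closed[OF one_closed \<xi>\<xi>] by (simp add: N.norm_star_mult)
  also have "\<dots> \<le> anorm (coeff_alg H P X) (amult BH (astar BH \<xi>) \<xi>)"
    using cstar_algebra.seminorm_le_norm[OF coeff_cstar coeff_seminorm] \<xi>\<xi> by (simp add: coeff_simps)
  finally show ?thesis by (rule real_le_rsqrt)
qed

end

text \<open>
The supremum defining the Toeplitz algebra is finite: generators are bounded by the previous lemma, then
words by submultiplicativity, then linear combinations by the triangle inequality.
\<close>

lemma admissible_seminorms_bounded:
  assumes "f \<in> carrier W"
  shows "\<exists>K. \<forall>N. admissible_seminorm W (toeplitz_relations H P X) N \<longrightarrow> N f \<le> K"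
proof -
  let ?adm = "admissible_seminorm W (toeplitz_relations H P X)"
  have adm: "seminormed_algebra W N" if "?adm N" for N
    using that by unfold_locales (simp add: admissible_seminorm_def)
  have letter: "\<exists>K. \<forall>N. ?adm N \<longrightarrow> N (basis_elt [l]) \<le> K" if l: "[l] \<in> letter_words" for l
  proof -
    obtain p \<xi> b where l_eq: "l = (p, \<xi>, b)" by (cases l)
    then have p: "p \<in> carrier P" "\<xi> \<in> X p" using l by (auto simp: letter_words_def)
    have "N (basis_elt [l]) = N (free_gen p \<xi>)" if "?adm N" for N
    proof (cases b)
      case True
      have "[(p, \<xi>, False)] \<in> letter_words" using p by (simp add: letter_words_def)
      then have "basis_elt [l] = astar W (free_gen p \<xi>)"
        using True by (simp add: free_gen_def basis_star adjoint_word_def l_eq)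
      then show ?thesis
        using seminormed_algebra.norm_star[OF adm[OF that] free_gen_closed[OF p]] by simp
    qed (simp add: free_gen_def l_eq)
    then show ?thesis using norm_free_gen_le[OF _ p] by metis
  qed
  have word: "\<exists>K. \<forall>N. ?adm N \<longrightarrow> N (basis_elt w) \<le> K" if "w \<in> letter_words" for w
    using that
  proof (induction w)
    case (Cons l w)
    have l: "[l] \<in> letter_words" using Cons.prems by (simp add: letter_words_def)
    obtain K where K: "\<And>N. ?adm N \<Longrightarrow> N (basis_elt [l]) \<le> K" using letter[OF l] by blast
    show ?case
    proof (cases "w = []")
      case False
      then have w: "w \<in> letter_words" using Cons.prems by (simp add: letter_words_def)
      obtain K' where K': "\<And>N. ?adm N \<Longrightarrow> N (basis_elt w) \<le> K'" using Cons.IH[OF w] by blast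
      have "N (basis_elt (l # w)) \<le> K * K'" if N: "?adm N" for N
      proof -
        interpret N: seminormed_algebra W N by (rule adm[OF N])
        have "N (basis_elt (l # w)) \<le> N (basis_elt [l]) * N (basis_elt w)"
          using N.norm_mult[of "basis_elt [l]" "basis_elt w"] l w by (simp add: basis_mult)
        also have "\<dots> \<le> K * K'"
        proof (rule mult_mono)
          show "0 \<le> K" using K[OF N] N.norm_nonneg[OF basis_closed[OF l]] by linarith
        qed (use K[OF N] K'[OF N] w in auto)
        finally show ?thesis .
      qed
      then show ?thesis by blast
    qed (use K in blast)
  qed (simp add: letter_words_def)
  show ?thesis
    using assms
  proof (induction rule: alg_induct)
    case zero
    then show ?case using seminormed_algebra.norm_zero[OF adm] by (metis order.refl)
  next
    case (basis w)
    then show ?case by (rule word)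
  next
    case (scale c f)
    then obtain K where K: "\<And>N. ?adm N \<Longrightarrow> N f \<le> K" by blast
    have "N (vscale W c f) \<le> cmod c * K" if "?adm N" for N
      using seminormed_algebra.norm_scale[OF adm[OF that] scale.hyps] K[OF that]
      by (simp add: mult_left_mono)
    then show ?case by blast
  next
    case (add f g)
    then obtain K K' where K: "\<And>N. ?adm N \<Longrightarrow> N f \<le> K" "\<And>N. ?adm N \<Longrightarrow> N g \<le> K'" by blast
    have "N (vadd W f g) \<le> K + K'" if "?adm N" for N
      using seminormed_algebra.norm_add[OF adm[OF that] add.hyps] K[OF that] by simp
    then show ?case by blast
  qed
qed

sublocale T: seminormed_algebra W "max_seminorm W (toeplitz_relations H P X)"
  using W.cstar_seminorm_max[OF admissible_seminorms_bounded] by unfold_locales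

lemma toeplitz_alg_eq: "toeplitz_alg H P X = completion W (max_seminorm W (toeplitz_relations H P X))"
  by (simp add: toeplitz_alg_def universal_cstar_def free_alg_eq)

lemma toeplitz_star_algebra: "star_algebra (toeplitz_alg H P X)"
  unfolding toeplitz_alg_eq by (rule T.completion_star_algebra)

text \<open>
Target algebras need not be unital, and there is no natural value for the empty word; it is not a basis
element of the free algebra, and its value \<open>0\<close> is a dummy.
\<close>

fun word_value :: "'b cstar \<Rightarrow> ('p \<Rightarrow> ('h \<Rightarrow> 'h) \<Rightarrow> 'b) \<Rightarrow> ('p, 'h \<Rightarrow> 'h) ps_word \<Rightarrow> 'b" where
  "word_value C t [] = vzero C"
| "word_value C t [(p, \<xi>, b)] = (if b then astar C (t p \<xi>) else t p \<xi>)"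
| "word_value C t (l # l' # w) = amult C (word_value C t [l]) (word_value C t (l' # w))"

lemma representation_extends_to_words:
  assumes rep: "representation H P X C t"
  obtains L where "star_hom W C L" "\<And>p \<xi>. \<lbrakk>p \<in> carrier P; \<xi> \<in> X p\<rbrakk> \<Longrightarrow> L (free_gen p \<xi>) = t p \<xi>"
proof -
  interpret C: cstar_algebra C using rep by (simp add: representation_def)
  let ?e = "word_value C t"
  have letter: "?e [l] \<in> carrier C" if "[l] \<in> letter_words" for l
    using that rep by (cases l) (auto simp: letter_words_def representation_def)
  have closed: "?e w \<in> carrier C" if "w \<in> letter_words" for w
    using that
  proof (induction w)
    case (Cons l w)
    then show ?case using letter[of l] by (cases w) (auto simp: letter_words_def)
  qed simp
  have value_Cons: "?e (l # w) = amult C (?e [l]) (?e w)" if "w \<in> letter_words" for l w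
    using that by (cases w) (simp_all add: letter_words_def)
  have mult: "?e (u @ v) = amult C (?e u) (?e v)" if "u \<in> letter_words" "v \<in> letter_words" for u v
    using that
  proof (induction u)
    case (Cons l u)
    show ?case
    proof (cases "u = []")
      case False
      then have u: "u \<in> letter_words" "[l] \<in> letter_words"
        using Cons.prems by (auto simp: letter_words_def)
      then show ?thesis
        using Cons.IH[OF u(1) Cons.prems(2)] Cons.prems(2) closed letter
        by (simp add: value_Cons[of "u @ v"] value_Cons[of u] C.mult_assoc)
    qed (use Cons.prems in \<open>simp add: value_Cons\<close>)
  qed (simp add: letter_words_def)
  have star_letter: "?e (adjoint_word [l]) = astar C (?e [l])" if "[l] \<in> letter_words" for l
    using that rep by (cases l) (auto simp: letter_words_def adjoint_word_def representation_def)
  have star: "?e (adjoint_word w) = astar C (?e w)" if "w \<in> letter_words" for w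
    using that
  proof (induction w)
    case (Cons l w)
    show ?case
    proof (cases "w = []")
      case False
      then have w: "w \<in> letter_words" "[l] \<in> letter_words"
        using Cons.prems by (auto simp: letter_words_def)
      have "adjoint_word (l # w) = adjoint_word w @ adjoint_word [l]"
        by (simp add: adjoint_word_def)
      then show ?thesis
        using w Cons.IH[OF w(1)] closed mult[of "adjoint_word w" "adjoint_word [l]"]
          mult[of "[l]" w] by (simp add: star_letter C.star_mult)
    qed (use Cons.prems star_letter in simp)
  qed (simp add: letter_words_def)
  obtain L where "star_hom W C L" "\<And>w. w \<in> letter_words \<Longrightarrow> L (basis_elt w) = ?e w"
    using semigroup_alg_hom[OF C.star_algebra_axioms closed mult star] by blast
  then show thesis by (intro that[of L]) (auto simp: free_gen_def letter_words_def)
qed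

text \<open>
The extension \<open>L\<close> of \<open>t\<close> to the free algebra identifies the two sides of each Toeplitz relation. Hence
\<open>x \<mapsto> \<parallel>L x\<parallel>\<close> is an admissible seminorm, the maximal seminorm dominates it, and \<open>L\<close> extends to the
completion.
\<close>

lemma toeplitz_universal:
  assumes rep: "representation H P X C t"
  shows "\<exists>\<phi>. star_hom (toeplitz_alg H P X) C \<phi> \<and>
    (\<forall>p\<in>carrier P. \<forall>\<xi>\<in>X p. \<phi> (toeplitz_gen H P X p \<xi>) = t p \<xi>)"
proof -
  interpret C: cstar_algebra C using rep by (simp add: representation_def)
  obtain L where L: "star_hom W C L"
    and L_gen: "\<And>p \<xi>. \<lbrakk>p \<in> carrier P; \<xi> \<in> X p\<rbrakk> \<Longrightarrow> L (free_gen p \<xi>) = t p \<xi>"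
    using representation_extends_to_words[OF rep] by metis
  have relation: "x \<in> carrier W \<and> y \<in> carrier W \<and> L x = L y"
    if "(x, y) \<in> toeplitz_relations H P X" for x y
  proof -
    have star_one: "t \<one>\<^bsub>P\<^esub> (astar BH a) = astar C (t \<one>\<^bsub>P\<^esub> a)" if "a \<in> X \<one>\<^bsub>P\<^esub>" for a
      using rep that by (simp add: representation_def star_hom_def coeff_simps)
    have L_add: "L (vadd W x y) = vadd C (L x) (L y)" and L_mult: "L (amult W x y) = amult C (L x) (L y)"
      if "x \<in> carrier W" "y \<in> carrier W" for x y using L that by (simp_all add: star_hom_def)
    have L_scale: "L (vscale W c x) = vscale C c (L x)" and L_star: "L (astar W x) = astar C (L x)"
      if "x \<in> carrier W" for x c using L that by (simp_all add: star_hom_def)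
    note ops = L_add L_mult L_scale L_star
    show ?thesis
      using that rep unfolding toeplitz_relations_def Let_def free_alg_eq representation_def
      by (elim UnE CollectE exE conjE Pair_inject; simp add: ops L_gen free_gen_closed star_one
          fibre_add fibre_scale fibre_mult fibre_star_mult one_closed mult_closed coeff_star)
  qed
  have L_adm: "admissible_seminorm W (toeplitz_relations H P X) (\<lambda>x. anorm C (L x))"
    unfolding admissible_seminorm_def
  proof (intro conjI)
    show "cstar_seminorm W (\<lambda>x. anorm C (L x))"
      using L C.norm_add C.norm_mult unfolding cstar_seminorm_def star_hom_def
      by (simp add: C.norm_scale C.norm_star_mult)
    show "\<forall>(x, y)\<in>toeplitz_relations H P X. anorm C (L (vsub W x y)) = 0"
      using L relation by (auto simp: star_hom_sub[OF W.complex_vs_axioms L] star_hom_def)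
  qed
  obtain \<phi> where \<phi>: "star_hom (toeplitz_alg H P X) C \<phi>"
    and \<phi>_eq: "\<And>x. x \<in> carrier W \<Longrightarrow>
      \<phi> (to_completion W (max_seminorm W (toeplitz_relations H P X)) x) = L x"
    using T.completion_induced_hom[OF C.cstar_algebra_axioms L
        W.le_max_seminorm[OF admissible_seminorms_bounded L_adm]]
    unfolding toeplitz_alg_eq by blast
  have "\<phi> (toeplitz_gen H P X p \<xi>) = t p \<xi>" if "p \<in> carrier P" "\<xi> \<in> X p" for p \<xi>
    using that \<phi>_eq[OF free_gen_closed] L_gen
    by (simp add: toeplitz_gen_def to_universal_def free_alg_eq)
  with \<phi> show ?thesis by blast
qed

text \<open>
The choice in the definition of \<open>induced_hom\<close> is made from a nonempty set.
\<close>

lemma induced_hom_is_hom: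
  "representation H P X C t \<Longrightarrow> star_hom (toeplitz_alg H P X) C (induced_hom H P X C t)"
  unfolding induced_hom_def using someI_ex[OF toeplitz_universal] by blast

end

section \<open>Covariance\<close>

lemma representation_rep_cstar:
  assumes rep: "representation H P X B t" and one: "\<one>\<^bsub>P\<^esub> \<in> carrier P"
  shows "representation H P X (rep_cstar P X B t) t"
proof -
  interpret B: cstar_algebra B using rep by (simp add: representation_def)
  let ?S = "\<Union>p\<in>carrier P. t p ` X p"
  have S: "?S \<subseteq> carrier B" using rep by (auto simp: representation_def)
  note C = B.cstar_generated_cstar_algebra[OF S]
  have t: "t p \<xi> \<in> cstar_generated B ?S" if "p \<in> carrier P" "\<xi> \<in> X p" for p \<xi>
    using C(2) that by blast
  show ?thesis
    using rep C(1) t t[OF one]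
    by (auto simp: representation_def rep_cstar_def star_hom_def coeff_alg_def)
qed

text \<open>
The kernel of the quotient map is the Fock ideal itself, and its image under the homomorphism \<open>t\<^sub>*\<close> is a
linear subspace; the latter needs that \<open>t\<^sub>*\<close> exists.
\<close>

lemma (in toeplitz_system) covariance_ideal_subspace:
  fixes G :: "('p, 'l) monoid_scheme"
  assumes rep: "representation H P X B t"
  shows "linear_subspace (rep_cstar P X B t) (covariance_ideal G H P X B t)"
proof -
  let ?C = "rep_cstar P X B t"
  note repC = representation_rep_cstar[OF rep one_closed]
  interpret C: cstar_algebra ?C using repC by (simp add: representation_def)
  interpret J: linear_subspace "toeplitz_alg H P X" "fock_ideal G H P X"
    unfolding fock_ideal_def Let_def
    by (rule ideal_generated_subspace[OF toeplitz_star_algebra]) (auto simp: alg_ker_def)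
  have "covariance_ideal G H P X B t = induced_hom H P X ?C t ` fock_ideal G H P X"
    by (simp add: covariance_ideal_def fock_cov_alg_def fock_quotient_def
        alg_ker_coset[OF J.linear_subspace_axioms])
  then show ?thesis
    using star_hom_image_subspace[OF J.linear_subspace_axioms C.complex_vs_axioms
        induced_hom_is_hom[OF repC]] by simp
qed

text \<open>
A linear map followed by the quotient map has kernel the preimage of \<open>I\<close>, and this preimage is zero
exactly when the map is injective and its range meets \<open>I\<close> trivially.
\<close>

lemma coset_injective_iff:
  assumes A: "complex_vs A" and hom: "star_hom A C \<phi>" and I: "linear_subspace C I"
  shows "inj_on (\<lambda>a. coset C I (\<phi> a)) (carrier A)
    \<longleftrightarrow> inj_on \<phi> (carrier A) \<and> \<phi> ` carrier A \<inter> I = {vzero C}"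
proof -
  interpret A: complex_vs A by (rule A)
  interpret I: linear_subspace C I by (rule I)
  have closed: "\<phi> a \<in> carrier C" if "a \<in> carrier A" for a
    using hom that by (simp add: star_hom_def)
  note sub = star_hom_sub[OF A hom]
  note zero = star_hom_zero[OF A I.complex_vs_axioms hom]
  have coset: "coset C I (\<phi> a) = coset C I (\<phi> b) \<longleftrightarrow> \<phi> (vsub A a b) \<in> I"
    if "a \<in> carrier A" "b \<in> carrier A" for a b
    using that closed by (simp add: I.coset_eq_iff sub)
  show ?thesis
  proof (intro iffI conjI)
    assume inj: "inj_on (\<lambda>a. coset C I (\<phi> a)) (carrier A)"
    show "inj_on \<phi> (carrier A)"
      using inj by (auto simp: inj_on_def)
    have "\<phi> a = vzero C" if "a \<in> carrier A" "\<phi> a \<in> I" for a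
      using inj_onD[OF inj, of a "vzero A"] that coset[of a "vzero A"] zero by simp
    then show "\<phi> ` carrier A \<inter> I = {vzero C}"
      using imageI[OF A.zero_closed, of \<phi>] I.zero_mem unfolding zero by auto
  next
    assume inj: "inj_on \<phi> (carrier A) \<and> \<phi> ` carrier A \<inter> I = {vzero C}"
    show "inj_on (\<lambda>a. coset C I (\<phi> a)) (carrier A)"
    proof (rule inj_onI)
      fix a b
      assume ab: "a \<in> carrier A" "b \<in> carrier A" "coset C I (\<phi> a) = coset C I (\<phi> b)"
      then have "\<phi> (vsub A a b) = vzero C" using inj coset by auto
      then have "\<phi> a = \<phi> b" using ab closed by (simp add: sub I.sub_eq_zero_iff)
      then show "a = b" using inj ab by (auto dest: inj_onD)
    qed
  qed
qed

theorem proposition4p10: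
  fixes G :: "('g, 'k) monoid_scheme" and P :: "'g set"
    and H :: "('h, complex) ipspace" and X :: "'g \<Rightarrow> ('h \<Rightarrow> 'h) set"
    and B :: "'b cstar" and t :: "'g \<Rightarrow> ('h \<Rightarrow> 'h) \<Rightarrow> 'b"
    and \<delta> :: "'b \<Rightarrow> ('b, 'g group_cstar_elt) tensor_elt"
  assumes "group G" and "submonoid P G"
    and "product_system H (G\<lparr>carrier := P\<rparr>) X"
    and "equivariant_rep G H (G\<lparr>carrier := P\<rparr>) X B t \<delta>"
  shows "injective_rep (G\<lparr>carrier := P\<rparr>) X t \<and> covariant_rep G H (G\<lparr>carrier := P\<rparr>) X B t \<delta>
    \<longleftrightarrow> injective_rep (G\<lparr>carrier := P\<rparr>) X (fock_cov_rep G H (G\<lparr>carrier := P\<rparr>) X B t)"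
proof -
  let ?P = "G\<lparr>carrier := P\<rparr>"
  let ?C = "rep_cstar ?P X B t" and ?I = "covariance_ideal G H ?P X B t" and ?A = "coeff_alg H ?P X"
  interpret toeplitz_system H ?P X by unfold_locales (rule assms)
  have rep: "representation H ?P X B t"
    and \<delta>: "\<And>p \<xi>. \<lbrakk>p \<in> P; \<xi> \<in> X p\<rbrakk>
      \<Longrightarrow> \<delta> (t p \<xi>) = elem_tensor ?C (max_group_cstar G) (t p \<xi>) (group_unitary G p)"
    using assms(4) by (auto simp: equivariant_rep_def)
  interpret I: linear_subspace ?C ?I by (rule covariance_ideal_subspace[OF rep])
  interpret A: cstar_algebra ?A by (rule coeff_cstar)
  have hom: "star_hom ?A ?C (t \<one>\<^bsub>G\<^esub>)"
    using representation_rep_cstar[OF rep one_closed] by (simp add: representation_def)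
  have carrier_A: "carrier ?A = X \<one>\<^bsub>G\<^esub>" by (simp add: coeff_alg_def)
  have zero: "vzero ?C = vzero B" by (simp add: rep_cstar_def)
  (* t(A) lies in the spectral subspace of the unit, by equivariance at p = e *)
  have "t \<one>\<^bsub>G\<^esub> ` X \<one>\<^bsub>G\<^esub> \<inter> spectral G ?C \<delta> ?I \<one>\<^bsub>G\<^esub> = t \<one>\<^bsub>G\<^esub> ` X \<one>\<^bsub>G\<^esub> \<inter> ?I"
    using \<delta> one_closed by (auto simp: spectral_def)
  moreover have "spectral G ?C \<delta> ?I \<one>\<^bsub>G\<^esub> = ?I \<inter> spectral G ?C \<delta> (carrier ?C) \<one>\<^bsub>G\<^esub>"
    using I.subset by (auto simp: spectral_def)
  ultimately have covariant: "covariant_rep G H ?P X B t \<delta> \<longleftrightarrow> t \<one>\<^bsub>G\<^esub> ` X \<one>\<^bsub>G\<^esub> \<inter> ?I = {vzero B}"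
    by (simp add: covariant_rep_def Let_def)
  show ?thesis
    using coset_injective_iff[OF A.complex_vs_axioms hom I.linear_subspace_axioms]
    unfolding covariant carrier_A zero by (simp add: injective_rep_def fock_cov_rep_def[abs_def])
qed

end
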